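(* Let $p \geq 2$ be a real number. There is a constant $C(p)$ depending only on $p$ such that the following holds. For every positive integer $N$, writing $\mathcal{P}_N = \mathcal{P} \cap [1,N]$ for the set of primes up to $N$, and for every sequence of complex numbers $(a_n)_{n \in \mathcal{P}_N}$ with $|a_n| \leq 1$ for all $n$, we have \[ \Big\Vert \sum_{n \in \mathcal{P}_N} a_n e(n\theta) \Big\Vert_{L^p(\mathbb{T})} \leq C(p) \Big\Vert \sum_{n \in \mathcal{P}_N} e(n\theta) \Big\Vert_{L^p(\mathbb{T})}. \]
   Context: $\mathbb{T} = \mathbb{R}/\mathbb{Z}$ with Lebesgue (Haar) probability measure $d\theta$, and $e(x) = e^{2\pi i x}$. The norms are $L^p$ norms of functions of $\theta \in \mathbb{T}$. *)

theory Defs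
  imports "HOL-Analysis.Analysis" "HOL-Computational_Algebra.Primes"
begin

definition e :: "real \<Rightarrow> complex" where
  "e x = exp (2 * complex_of_real pi * \<i> * complex_of_real x)"

text \<open>Functions on the circle \<open>\<real> / \<int>\<close> are represented by 1-periodic functions on the reals,
  and the Haar probability measure by Lebesgue measure on the fundamental domain \<open>[0, 1)\<close>.\<close>

definition circle_measure :: "real measure" where
  "circle_measure = restrict_space lborel {0..<1}"

text \<open>This is the $L^p$ norm for \<open>p > 0\<close> and \<open>f\<close> in $L^p$. If the integral diverges, the Bochner
  integral has the junk value 0; here the norm is only applied to trigonometric polynomials, which
  are bounded.\<close>

definition Lp_norm :: "real \<Rightarrow> 'a measure \<Rightarrow> ('a \<Rightarrow> complex) \<Rightarrow> real" where
  "Lp_norm p M f = (LINT x|M. norm (f x) powr p) powr (1 / p)"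

definition primes_upto :: "nat \<Rightarrow> nat set" where
  "primes_upto N = {n. prime n} \<inter> {1..N}"

end

theory Submission
  imports Defs "HOL-Computational_Algebra.Squarefree" "HOL-Number_Theory.Totient"
begin

text \<open>
  For \<open>p = 2\<close> the claim is Parseval's identity. For \<open>p > 2\<close> it follows from a large sieve inequality
  for primes: if \<open>\<theta>\<^sub>1, \<dots>, \<theta>\<^sub>J\<close> are \<open>1/(2N)\<close>-separated modulo 1 and \<open>S\<close> is an exponential sum over primes
  up to \<open>N\<close> with coefficients bounded by 1, then the sum of \<open>|S(\<theta>\<^sub>j)|\<^sup>2\<close> is at most
  $C_\varepsilon\, \pi(N)^2 J^\varepsilon$. Hence the \<open>j\<close>-th largest value of \<open>|S|\<^sup>2\<close> on a separated set is at most
  $C_\varepsilon\, \pi(N)^2 j^{\varepsilon-1}$, and summing the powers \<open>p/2 > 1\<close> bounds the integral of \<open>|S|\<^sup>p\<close> by a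
  constant times $\pi(N)^p/N$. The majorant \<open>\<Sum> e(n\<theta>)\<close> attains this size on \<open>0 \<le> \<theta> \<le> 1/(6N)\<close> alone.

  The inequality for primes comes from $|S(\theta)|^2 \le \varphi(q) \sum_{(k,q)=1} |S(\theta+k/q)|^2$, valid for
  squarefree \<open>q\<close> coprime to all frequencies, summed over \<open>q \<le> Q\<close> with weights $1/\varphi(q)$. The points
  \<open>\<theta>\<^sub>j + k/q\<close> can collide for different \<open>j\<close> only if \<open>\<theta>\<^sub>i - \<theta>\<^sub>j\<close> is close to a rational, which is then unique
  and not an integer; removing, for each pair, the multiples of one prime factor of its denominator
  from the moduli \<open>q\<close> makes all points separated, so that the ordinary large sieve applies. At most
  \<open>J\<^sup>2\<close> primes are removed, which diminishes the sum of the $1/\varphi(q)$, of order \<open>log Q\<close>, by a factor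
  \<open>\<Prod> p/(p-1)\<close> over these primes, and this is $O_\varepsilon(J^\varepsilon)$ by Chebyshev's upper bound.
\<close>

section \<open>Ramanujan sums\<close>

lemma e_eq_cis: "e x = cis (2 * pi * x)"
  by (simp add: e_def cis_conv_exp mult_ac)

lemma e_add: "e (x + y) = e x * e y"
  by (simp add: e_eq_cis cis_mult algebra_simps)

lemma norm_e [simp]: "norm (e x) = 1"
  by (simp add: e_eq_cis)

lemma cnj_e: "cnj (e x) = e (- x)"
  by (simp add: e_eq_cis cis_cnj)

lemma e_eq_1_iff: "e x = 1 \<longleftrightarrow> x \<in> \<int>"
proof
  assume "e x = 1"
  then have "cos (2 * pi * x) = 1"
    by (simp add: e_eq_cis complex_eq_iff)
  then obtain k :: int where "2 * pi * x = of_int k * 2 * pi"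
    using cos_one_2pi_int by auto
  then have "x = of_int k" by simp
  then show "x \<in> \<int>" by simp
next
  assume "x \<in> \<int>"
  then obtain k :: int where "x = of_int k" by (auto elim: Ints_cases)
  then show "e x = 1"
    by (simp add: e_eq_cis)
qed

lemma e_of_nat_mult: "e (real n * x) = e x ^ n"
  by (simp add: e_eq_cis Complex.DeMoivre mult_ac)

lemma sum_e_over_residues:
  assumes "p > 0" "\<not> p dvd n"
  shows "(\<Sum>i<p. e (real i * (real n / real p))) = 0"
proof -
  let ?z = "e (real n / real p)"
  have "real n / real p \<notin> \<int>"
  proof
    assume "real n / real p \<in> \<int>"
    then obtain k :: int where "real n / real p = of_int k" by (auto elim: Ints_cases)
    then have "real n = real p * of_int k" using assms by (simp add: field_simps)
    then have "int n = int p * k"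
      by (metis of_int_eq_iff of_int_mult of_int_of_nat_eq)
    then have "int p dvd int n" by simp
    then show False using assms by simp
  qed
  then have "?z \<noteq> 1" by (simp add: e_eq_1_iff)
  moreover have "?z ^ p = 1"
    using assms by (simp add: e_of_nat_mult [symmetric] e_eq_1_iff)
  ultimately show ?thesis
    unfolding e_of_nat_mult by (simp add: geometric_sum)
qed

text \<open>A new prime factor flips the sign. The numbers up to \<open>p * q\<close> coprime to
  \<open>q\<close> are the totatives of \<open>p * q\<close> and the multiples \<open>p * b\<close>
  of totatives \<open>b\<close> of \<open>q\<close>. Over all of them the sum vanishes: in the form
  \<open>b + q * i\<close>, the sum over \<open>i\<close> runs through all powers of a nontrivial
  \<open>p\<close>-th root of unity.\<close>

lemma ramanujan_sum_prime_mult: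
  assumes p: "prime p" and q: "q > 0" "coprime p q" and n: "\<not> p dvd n"
  shows "(\<Sum>a\<in>totatives (p * q). e (real a * real n / real (p * q))) =
         - (\<Sum>b\<in>totatives q. e (real b * real n / real q))"
proof -
  let ?f = "\<lambda>a. e (real a * real n / real (p * q))"
  have p0: "p > 0" using p by (simp add: prime_gt_0_nat)
  have coq: "coprime (b + q * i) q \<longleftrightarrow> coprime b q" for b i
    unfolding coprime_iff_gcd_eq_1
    using gcd_add_mult[of q i b] by (metis add.commute gcd.commute mult.commute)
  define U where "U = {a \<in> {0<..p * q}. coprime a q}"
  have "bij_betw (\<lambda>(b, i). b + q * i) (totatives q \<times> {..<p}) U"
  proof (intro bij_betw_imageI inj_onI)
    fix x y
    assume xy: "x \<in> totatives q \<times> {..<p}" "y \<in> totatives q \<times> {..<p}"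
      "(case x of (b, i) \<Rightarrow> b + q * i) = (case y of (b, i) \<Rightarrow> b + q * i)"
    obtain b i c j where [simp]: "x = (b, i)" "y = (c, j)" by (cases x, cases y)
    have bounds: "0 < b" "b \<le> q" "0 < c" "c \<le> q" and eq: "b + q * i = c + q * j"
      using xy by (auto simp: in_totatives_iff)
    \<comment> \<open>Totatives of \<open>q\<close> lie in \<open>1..q\<close>, so \<open>i\<close>
      is the quotient by \<open>q\<close> only after subtracting 1.\<close>
    have "(b - 1) + q * i = (c - 1) + q * j" using bounds eq by linarith
    moreover have "((b - 1) + q * i) div q = i" "((c - 1) + q * j) div q = j"
      using bounds q by (simp_all only: div_mult_self2 div_less diff_less)
    ultimately have "i = j" by metis
    then show "x = y" using eq by simp
  next
    show "(\<lambda>(b, i). b + q * i) ` (totatives q \<times> {..<p}) = U"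
    proof (intro equalityI subsetI)
      fix x assume "x \<in> (\<lambda>(b, i). b + q * i) ` (totatives q \<times> {..<p})"
      then obtain b i where x: "x = b + q * i" "b \<in> totatives q" "i < p" by auto
      have "q * i + q \<le> p * q"
        using mult_le_mono2[of "Suc i" p q] x by (simp add: algebra_simps)
      then show "x \<in> U"
        using x coq[of b i] by (auto simp: U_def in_totatives_iff)
    next
      fix x assume x: "x \<in> U"
      define i where "i = (x - 1) div q"
      define b where "b = (x - 1) mod q + 1"
      have xe: "x = b + q * i"
        using x by (simp add: b_def i_def U_def)
      have "x - 1 < p * q" using x p0 q by (auto simp: U_def)
      then have "i < p" by (simp add: i_def less_mult_imp_div_less)
      moreover have "b \<in> totatives q"
        using x q coq[of b i] unfolding in_totatives_iff xe[symmetric]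
        by (auto simp: U_def b_def Suc_le_eq)
      ultimately show "x \<in> (\<lambda>(b, i). b + q * i) ` (totatives q \<times> {..<p})"
        using xe by force
    qed
  qed
  then have "(\<Sum>a\<in>U. ?f a) = (\<Sum>(b, i)\<in>totatives q \<times> {..<p}. ?f (b + q * i))"
    by (subst sum.reindex_bij_betw[symmetric]) (auto simp: case_prod_unfold)
  also have "\<dots> = (\<Sum>b\<in>totatives q. \<Sum>i<p. ?f (b + q * i))"
    by (simp add: sum.cartesian_product)
  also have "\<dots> = (\<Sum>b\<in>totatives q. ?f b * (\<Sum>i<p. e (real i * (real n / real p))))"
    unfolding sum_distrib_left
  proof (intro sum.cong refl)
    fix b i
    have "real (b + q * i) * real n / real (p * q) =
          real b * real n / real (p * q) + real i * (real n / real p)"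
      using p0 q by (simp add: field_simps)
    then show "?f (b + q * i) = ?f b * e (real i * (real n / real p))"
      by (simp only: e_add)
  qed
  also have "\<dots> = 0"
    using sum_e_over_residues[OF p0 n] by simp
  finally have U0: "(\<Sum>a\<in>U. ?f a) = 0" .
  have "U = totatives (p * q) \<union> (*) p ` totatives q"
  proof (intro equalityI subsetI)
    fix a assume a: "a \<in> U"
    show "a \<in> totatives (p * q) \<union> (*) p ` totatives q"
    proof (cases "p dvd a")
      case True
      then obtain b where b: "a = p * b" by auto
      then have "b \<in> totatives q"
        using a p0 by (auto simp: U_def in_totatives_iff)
      then show ?thesis using b by auto
    next
      case False
      then have "coprime a p" using p by (metis coprime_commute prime_imp_coprime)
      then show ?thesis
        using a by (auto simp: U_def in_totatives_iff)
    qed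
  next
    fix a assume "a \<in> totatives (p * q) \<union> (*) p ` totatives q"
    then show "a \<in> U"
      using p0 q by (auto simp: U_def in_totatives_iff)
  qed
  moreover have "totatives (p * q) \<inter> (*) p ` totatives q = {}"
    using p by (auto simp: in_totatives_iff)
  ultimately have "(\<Sum>a\<in>U. ?f a) =
      (\<Sum>a\<in>totatives (p * q). ?f a) + (\<Sum>a\<in>(*) p ` totatives q. ?f a)"
    by (simp add: sum.union_disjoint)
  also have "(\<Sum>a\<in>(*) p ` totatives q. ?f a) = (\<Sum>b\<in>totatives q. ?f (p * b))"
    using p0 by (subst sum.reindex) (auto simp: inj_on_def)
  also have "\<dots> = (\<Sum>b\<in>totatives q. e (real b * real n / real q))"
    using p0 by (intro sum.cong refl) (simp add: field_simps)
  finally show ?thesis using U0 by (simp add: eq_neg_iff_add_eq_0)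
qed

text \<open>Removing one prime factor at a time shows that \<open>s\<close> is the Moebius function
  at \<open>q\<close>. What matters later is that \<open>s\<close> is unimodular and the same for
  all \<open>n\<close> coprime to \<open>q\<close>.\<close>

lemma ramanujan_sum_squarefree:
  assumes "squarefree q"
  shows "\<exists>s::complex. norm s = 1 \<and>
    (\<forall>n. coprime n q \<longrightarrow> (\<Sum>a\<in>totatives q. e (real a * real n / real q)) = s)"
  using assms
proof (induction q rule: less_induct)
  case (less q)
  have q0: "q > 0" using less.prems by (auto intro: Nat.gr0I)
  show ?case
  proof (cases "q = 1")
    case True
    have "e (real n) = 1" for n by (simp add: e_eq_1_iff)
    then show ?thesis using True by (intro exI[of _ 1]) simp
  next
    case False
    then obtain p where p: "prime p" "p dvd q" using prime_factor_nat by blast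
    then obtain r where r: "q = p * r" by auto
    have r0: "r > 0" and "r < q" using q0 r prime_gt_1_nat[OF p(1)] by auto
    have sr: "squarefree r" using less.prems r squarefree_mono dvd_triv_right by metis
    have cop: "coprime p r"
    proof (rule ccontr)
      assume "\<not> coprime p r"
      then have "p dvd r" using p prime_imp_coprime by blast
      then have "p ^ 2 dvd q" by (auto simp: r power2_eq_square)
      then show False using less.prems p unfolding squarefree_def by auto
    qed
    from less.IH[OF \<open>r < q\<close> sr] obtain s where s: "norm s = 1"
      "\<And>n. coprime n r \<Longrightarrow> (\<Sum>a\<in>totatives r. e (real a * real n / real r)) = s" by blast
    have "(\<Sum>a\<in>totatives q. e (real a * real n / real q)) = - s" if "coprime n q" for n
    proof -
      have "\<not> p dvd n" using that p by (metis coprime_common_divisor not_prime_unit)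
      moreover have "coprime n r" using that r by simp
      ultimately show ?thesis
        using ramanujan_sum_prime_mult[OF p(1) r0 cop] s(2) r by auto
    qed
    then show ?thesis using s(1) by (intro exI[of _ "- s"]) auto
  qed
qed

section \<open>Reciprocal totients of squarefree numbers\<close>

definition squarefree_avoiding :: "nat set \<Rightarrow> nat \<Rightarrow> nat set" where
  "squarefree_avoiding B Q = {q \<in> {1..Q}. squarefree q \<and> (\<forall>p\<in>B. \<not> p dvd q)}"

lemma finite_squarefree_avoiding [simp]: "finite (squarefree_avoiding B Q)"
  by (simp add: squarefree_avoiding_def)

text \<open>Equals 1 + 1/\<phi>(p), the factor at \<open>p\<close> in the formal Euler product of
  the sum of 1/\<phi>(q) over squarefree \<open>q\<close>.\<close>

definition euler_factor :: "nat \<Rightarrow> real" where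
  "euler_factor p = real p / (real p - 1)"

lemma euler_factor_ge_1: "prime p \<Longrightarrow> euler_factor p \<ge> 1"
  using prime_gt_1_nat[of p] by (simp add: euler_factor_def field_simps)

text \<open>Squarefree multiples of \<open>p\<close> are \<open>p * r\<close> with \<open>r\<close>
  coprime to \<open>p\<close>, and \<phi>(p r) = (p - 1) \<phi>(r). They contribute at most 1/(p -
  1) times the sum over \<open>r\<close>, and 1 + 1/(p - 1) is the Euler factor.\<close>

lemma sum_inverse_totient_insert:
  assumes p: "prime p"
  shows "(\<Sum>q\<in>squarefree_avoiding B Q. 1 / real (totient q)) \<le>
         euler_factor p * (\<Sum>q\<in>squarefree_avoiding (insert p B) Q. 1 / real (totient q))"
proof -
  let ?f = "\<lambda>q. 1 / real (totient q)"
  let ?D = "{q \<in> squarefree_avoiding B Q. p dvd q}"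
  let ?S = "squarefree_avoiding (insert p B) Q"
  have p1: "real p > 1" using prime_gt_1_nat[OF p] by simp
  have cop: "coprime p (q div p)" if "q \<in> ?D" for q
  proof (rule ccontr)
    assume "\<not> coprime p (q div p)"
    then have "p dvd q div p" using p prime_imp_coprime by blast
    then have "p ^ 2 dvd q" using that
      by (metis (no_types, lifting) dvd_div_iff_mult mem_Collect_eq power2_eq_square not_prime_0 p)
    then show False using that p unfolding squarefree_avoiding_def squarefree_def by auto
  qed
  have "squarefree_avoiding B Q = ?S \<union> ?D"
    by (auto simp: squarefree_avoiding_def)
  moreover have "?S \<inter> ?D = {}" by (auto simp: squarefree_avoiding_def)
  ultimately have "(\<Sum>q\<in>squarefree_avoiding B Q. ?f q) = (\<Sum>q\<in>?S. ?f q) + (\<Sum>q\<in>?D. ?f q)"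
    by (metis (no_types, lifting) finite_Un finite_squarefree_avoiding sum.union_disjoint)
  also have "(\<Sum>q\<in>?D. ?f q) = (\<Sum>q\<in>?D. 1 / (real p - 1) * ?f (q div p))"
  proof (intro sum.cong refl)
    fix q assume q: "q \<in> ?D"
    have "totient q = totient p * totient (q div p)"
      using totient_mult_coprime[OF cop[OF q]] q by simp
    then show "?f q = 1 / (real p - 1) * ?f (q div p)"
      using p prime_ge_1_nat[OF p] by (simp add: totient_prime)
  qed
  also have "\<dots> = 1 / (real p - 1) * (\<Sum>q\<in>(\<lambda>q. q div p) ` ?D. ?f q)"
    by (subst sum.reindex) (auto simp: inj_on_def sum_distrib_left dvd_div_eq_iff)
  also have "\<dots> \<le> 1 / (real p - 1) * (\<Sum>q\<in>?S. ?f q)"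
  proof (intro mult_left_mono sum_mono2)
    show "(\<lambda>q. q div p) ` ?D \<subseteq> ?S"
    proof
      fix r assume "r \<in> (\<lambda>q. q div p) ` ?D"
      then obtain q where q: "q \<in> ?D" "r = q div p" by auto
      have rq: "r dvd q" using q by auto
      have q': "0 < q" "q \<le> Q" "squarefree q" "\<And>b. b \<in> B \<Longrightarrow> \<not> b dvd q"
        using q(1) by (auto simp: squarefree_avoiding_def)
      have "0 < r" using rq q'(1) by (rule dvd_pos_nat[rotated])
      moreover have "r \<le> Q" using dvd_imp_le[OF rq q'(1)] q'(2) by simp
      moreover have "squarefree r" using rq q'(3) by (rule squarefree_mono)
      moreover have "\<not> b dvd r" if "b \<in> B" for b
        using q'(4)[OF that] rq dvd_trans by blast
      moreover have "\<not> p dvd r"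
        using cop[OF q(1)] q(2) p by (metis coprime_common_divisor dvd_refl not_prime_unit)
      ultimately show "r \<in> ?S"
        by (auto simp: squarefree_avoiding_def)
    qed
  qed (use p1 in auto)
  also have "(\<Sum>q\<in>?S. ?f q) + \<dots> = euler_factor p * (\<Sum>q\<in>?S. ?f q)"
    using p1 by (simp add: euler_factor_def field_simps)
  finally show ?thesis by simp
qed

text \<open>Telescoping, as 1/(n+1)^2 \<le> 1/n - 1/(n+1). Division by 0 gives 0, so the case
  \<open>n = 0\<close> reads 0 \<le> 2.\<close>

lemma sum_inverse_squares_le: "(\<Sum>m=1..n. 1 / real m ^ 2) \<le> 2 - 1 / real n"
proof (induction n)
  case (Suc n)
  show ?case
  proof (cases "n = 0")
    case False
    then have "1 / real (Suc n) ^ 2 \<le> 1 / real n - 1 / real (Suc n)"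
      by (simp add: divide_simps power2_eq_square)
    then show ?thesis using Suc by simp
  qed simp
qed simp

text \<open>Writing n = s m^2 with \<open>s\<close> squarefree bounds the harmonic sum by the sum of
  1/s times the sum of 1/m^2. The latter is at most 2, and 1/s \<le> 1/\<phi>(s).\<close>

lemma harmonic_le_sum_inverse_totient:
  "(\<Sum>n=1..Q. 1 / real n) \<le> 2 * (\<Sum>q\<in>squarefree_avoiding {} Q. 1 / real (totient q))"
proof -
  let ?S = "squarefree_avoiding {} Q"
  define g where "g = (\<lambda>n::nat. (squarefree_part n, square_part n))"
  define w where "w = (\<lambda>(s, m). 1 / real s * (1 / real m ^ 2))"
  have dec: "n = squarefree_part n * square_part n ^ 2" for n :: nat
    by (rule squarefree_decompose)
  have inj: "inj_on g {1..Q}"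
    by (rule inj_onI) (metis dec g_def prod.inject)
  have img: "g ` {1..Q} \<subseteq> ?S \<times> {1..Q}"
  proof
    fix x assume "x \<in> g ` {1..Q}"
    then obtain n where n: "n \<in> {1..Q}" "x = g n" by auto
    have "squarefree_part n dvd n" "square_part n dvd n"
      using dec[of n] by (metis dvd_triv_left, metis dvd_mult dvd_power zero_less_numeral)
    then show "x \<in> ?S \<times> {1..Q}"
      using n by (auto simp: g_def squarefree_avoiding_def Suc_le_eq
          intro!: Nat.gr0I dest: dvd_imp_le)
  qed
  have "(\<Sum>n=1..Q. 1 / real n) = (\<Sum>n=1..Q. w (g n))"
    by (intro sum.cong refl, subst dec) (simp add: w_def g_def)
  also have "\<dots> = (\<Sum>x\<in>g ` {1..Q}. w x)"
    using sum.reindex[OF inj, of w] by (simp add: o_def)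
  also have "\<dots> \<le> (\<Sum>x\<in>?S \<times> {1..Q}. w x)"
    by (intro sum_mono2 img) (auto simp: w_def)
  also have "\<dots> = (\<Sum>s\<in>?S. 1 / real s) * (\<Sum>m=1..Q. 1 / real m ^ 2)"
    by (simp add: w_def sum_product sum.cartesian_product)
  also have "\<dots> \<le> (\<Sum>s\<in>?S. 1 / real (totient s)) * 2"
  proof (intro mult_mono sum_mono)
    fix s assume "s \<in> ?S"
    then have "totient s > 0" by (simp add: squarefree_avoiding_def)
    then show "1 / real s \<le> 1 / real (totient s)"
      by (intro divide_left_mono) (auto simp: totient_le intro!: Nat.gr0I)
  next
    have "2 - 1 / real Q \<le> 2" by simp
    then show "(\<Sum>m=1..Q. 1 / real m ^ 2) \<le> 2"
      using sum_inverse_squares_le[of Q] by linarith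
  qed (auto intro!: sum_nonneg)
  finally show ?thesis by simp
qed

lemma ln_Suc_le_harmonic: "ln (real (Suc n)) \<le> (\<Sum>m=1..n. 1 / real m)"
proof (induction n)
  case (Suc n)
  have "ln (real (Suc (Suc n))) - ln (real (Suc n)) = ln (1 + 1 / real (Suc n))"
    by (subst ln_divide_pos [symmetric]) (simp_all add: field_simps)
  also have "\<dots> \<le> 1 / real (Suc n)"
    by (rule ln_add_one_self_le_self) simp
  finally show ?case using Suc by simp
qed simp

text \<open>With nothing excluded the harmonic sum gives the bound; excluding the primes of
  \<open>B\<close> one by one costs one Euler factor each.\<close>

lemma ln_le_sum_inverse_totient_avoiding:
  assumes "finite B" "\<And>p. p \<in> B \<Longrightarrow> prime p"
  shows "ln (real (Suc Q)) \<le>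
    2 * (\<Prod>p\<in>B. euler_factor p) * (\<Sum>q\<in>squarefree_avoiding B Q. 1 / real (totient q))"
  using assms
proof (induction B rule: finite_induct)
  case empty
  then show ?case
    using ln_Suc_le_harmonic[of Q] harmonic_le_sum_inverse_totient[of Q] by simp
next
  case (insert p B)
  let ?H = "\<lambda>B. \<Sum>q\<in>squarefree_avoiding B Q. 1 / real (totient q)"
  let ?P = "\<lambda>B. \<Prod>p\<in>B. euler_factor p"
  have "?P B \<ge> 0"
    using insert.prems euler_factor_ge_1
    by (intro prod_nonneg) (auto intro: order_trans[OF zero_le_one])
  then have "2 * ?P B * ?H B \<le> 2 * ?P B * (euler_factor p * ?H (insert p B))"
    using insert.prems by (intro mult_left_mono sum_inverse_totient_insert) auto
  also have "\<dots> = 2 * ?P (insert p B) * ?H (insert p B)"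
    using insert.hyps by simp
  finally show ?case using insert.IH insert.prems by force
qed

section \<open>Chebyshev bounds\<close>

text \<open>With n = 2^k, every prime in (n, 2n] divides the central binomial coefficient, which is
  at most 4^n. The product of these primes is at least n^card, and comparing exponents of 2 gives
  the bound.\<close>

lemma card_primes_dyadic_le: "k * card {p::nat. prime p \<and> 2 ^ k < p \<and> p \<le> 2 ^ Suc k} \<le> 2 ^ Suc k"
proof -
  define n :: nat where "n = 2 ^ k"
  define P where "P = {p::nat. prime p \<and> n < p \<and> p \<le> 2 * n}"
  have fin: "finite P" by (rule finite_subset[of _ "{..2 * n}"]) (auto simp: P_def)
  have dvd: "p dvd (2 * n) choose n" if "p \<in> P" for p
  proof -
    have "p dvd fact n * fact n * ((2 * n) choose n)"
      using that binomial_fact_lemma[of n "2 * n"] prime_dvd_fact_iff[of p "2 * n"]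
      by (simp add: P_def mult_2)
    moreover have "\<not> p dvd fact n"
      using that prime_dvd_fact_iff[of p n] by (simp add: P_def)
    ultimately show ?thesis
      using that by (simp add: P_def prime_dvd_mult_iff)
  qed
  have "\<Prod>P' dvd (2 * n) choose n" if "P' \<subseteq> P" for P'
    using finite_subset[OF that fin] that
  proof (induction P' rule: finite_induct)
    case (insert p P')
    have "coprime p (\<Prod>P')"
      using insert by (intro prod_coprime_right primes_coprime) (auto simp: P_def)
    then show ?case
      using insert dvd[of p] by (simp add: divides_mult)
  qed simp
  then have "\<Prod>P dvd (2 * n) choose n" by blast
  then have "\<Prod>P \<le> (2 * n) choose n" by (rule dvd_imp_le) simp
  moreover have "n ^ card P \<le> \<Prod>P"
    using prod_mono[of P "\<lambda>_. n" "\<lambda>p. p"] by (simp add: P_def)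
  moreover have "(2 * n) choose n \<le> 2 ^ (2 * n)" by (rule binomial_le_pow2)
  ultimately have "(2::nat) ^ (k * card P) \<le> 2 ^ (2 * n)"
    by (simp add: n_def power_mult)
  then have "k * card P \<le> 2 * n" by (rule power_le_imp_le_exp[rotated]) simp
  then show ?thesis by (simp add: n_def P_def)
qed

section \<open>Products of Euler factors over sets of primes\<close>

lemma prod_euler_factor_large:
  assumes "finite B" "\<And>p. p \<in> B \<Longrightarrow> prime p \<and> M < p" "M > 0"
  shows "(\<Prod>p\<in>B. euler_factor p) \<le> exp (real (card B) / real M)"
proof -
  have "euler_factor p \<le> exp (1 / real M)" if "p \<in> B" for p
  proof -
    have p: "real M \<le> real p - 1" "p > 1"
      using assms(2)[OF that] prime_gt_1_nat[of p] by auto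
    have "euler_factor p = 1 + 1 / (real p - 1)"
      using p by (simp add: euler_factor_def field_simps)
    also have "\<dots> \<le> 1 + 1 / real M"
      using p assms(3) by (intro add_left_mono divide_left_mono) auto
    also have "\<dots> \<le> exp (1 / real M)" by (rule exp_ge_add_one_self)
    finally show ?thesis .
  qed
  then have "(\<Prod>p\<in>B. euler_factor p) \<le> (\<Prod>p\<in>B. exp (1 / real M))"
    using assms(2) euler_factor_ge_1 by (intro prod_mono) (auto intro: order_trans[of 0 1])
  also have "\<dots> = exp (real (card B) / real M)"
    by (simp add: exp_of_nat_mult [symmetric])
  finally show ?thesis .
qed

text \<open>By Chebyshev's upper bound the primes in (2^k, 2^(k+1)] contribute at most exp(2/k),
  which is at most 2^\<epsilon> once k \<ge> K. The earlier blocks go into the constant.\<close>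

lemma prod_euler_factor_dyadic_le:
  fixes \<epsilon> :: real
  assumes "\<epsilon> > 0"
  shows "\<exists>C>0. \<forall>k. (\<Prod>p\<in>{p::nat. prime p \<and> p \<le> 2 ^ k}. euler_factor p) \<le> C * 2 powr (\<epsilon> * real k)"
proof -
  define P where "P = (\<lambda>k. {p::nat. prime p \<and> p \<le> 2 ^ k})"
  define E where "E = (\<lambda>k. \<Prod>p\<in>P k. euler_factor p)"
  have fin: "finite (P k)" for k
    by (rule finite_subset[of _ "{..2 ^ k}"]) (auto simp: P_def)
  have E1: "E k \<ge> 1" for k
    unfolding E_def by (intro prod_ge_1) (auto simp: P_def euler_factor_ge_1)
  obtain K :: nat where K: "real K > 2 / (\<epsilon> * ln 2)" using reals_Archimedean2 by blast
  have "2 / (\<epsilon> * ln 2) > 0" using assms by simp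
  then have K0: "K > 0" using K by (metis of_nat_0_less_iff order_less_trans)
  have step: "E (Suc k) \<le> E k * 2 powr \<epsilon>" if "k \<ge> K" for k
  proof -
    let ?D = "{p::nat. prime p \<and> 2 ^ k < p \<and> p \<le> 2 ^ Suc k}"
    have k0: "k > 0" using that K0 by simp
    have finD: "finite ?D" by (rule finite_subset[of _ "{..2 ^ Suc k}"]) auto
    have "P (Suc k) = P k \<union> ?D" by (auto simp: P_def)
    then have "E (Suc k) = E k * (\<Prod>p\<in>?D. euler_factor p)"
      unfolding E_def using fin finD by (subst prod.union_disjoint[symmetric]) (auto simp: P_def)
    also have "\<dots> \<le> E k * 2 powr \<epsilon>"
    proof (rule mult_left_mono)
      have "(\<Prod>p\<in>?D. euler_factor p) \<le> exp (real (card ?D) / real (2 ^ k))"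
        by (rule prod_euler_factor_large[OF finD]) auto
      also have "real (card ?D) / real (2 ^ k) \<le> 2 / real k"
      proof -
        have "real (k * card ?D) \<le> real (2 ^ Suc k)"
          using card_primes_dyadic_le[of k] by (simp only: of_nat_le_iff)
        then show ?thesis using k0 by (simp add: field_simps)
      qed
      also have "2 / real k \<le> 2 / real K"
        using that K0 by (intro divide_left_mono) auto
      also have "2 / real K \<le> \<epsilon> * ln 2"
        using K K0 assms by (simp add: field_simps)
      finally show "(\<Prod>p\<in>?D. euler_factor p) \<le> 2 powr \<epsilon>"
        by (simp add: powr_def)
    qed (use E1[of k] in simp)
    finally show ?thesis .
  qed
  have up: "E (K + j) \<le> E K * 2 powr (\<epsilon> * real j)" for j
  proof (induction j)
    case (Suc j)
    have "E (K + Suc j) \<le> E (K + j) * 2 powr \<epsilon>" using step[of "K + j"] by simp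
    also have "\<dots> \<le> E K * 2 powr (\<epsilon> * real j) * 2 powr \<epsilon>"
      using Suc by (intro mult_right_mono) auto
    finally show ?case by (simp add: algebra_simps powr_add)
  qed simp
  have mono: "E k \<le> E K" if "k \<le> K" for k
  proof -
    have "(2::nat) ^ k \<le> 2 ^ K" using that by (intro power_increasing) auto
    then have "P k \<subseteq> P K" unfolding P_def using order_trans by blast
    then show ?thesis
      unfolding E_def using fin by (intro prod_mono2) (auto simp: P_def intro: euler_factor_ge_1 order_trans[OF zero_le_one])
  qed
  have "E k \<le> E K * 2 powr (\<epsilon> * real k)" for k
  proof (cases "k \<le> K")
    case True
    have "E k * 1 \<le> E K * 2 powr (\<epsilon> * real k)"
      using mono[OF True] E1[of K] assms by (intro mult_mono) (auto simp: ge_one_powr_ge_zero)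
    then show ?thesis by simp
  next
    case False
    then obtain j where j: "k = K + j" using le_Suc_ex nat_le_linear by blast
    have "E k \<le> E K * 2 powr (\<epsilon> * real j)" using up j by simp
    also have "\<dots> \<le> E K * 2 powr (\<epsilon> * real k)"
      using E1[of K] assms j by (intro mult_left_mono powr_mono) auto
    finally show ?thesis .
  qed
  then show ?thesis using E1[of K] unfolding E_def P_def
    by (intro exI[of _ "E K"]) (auto simp: E_def P_def intro: less_le_trans[OF zero_less_one])
qed

text \<open>Let 2^(k+1) be the power of two just above the size of \<open>B\<close>. Primes up to it
  fall under the dyadic bound; fewer than 2^(k+1) larger ones remain, each with Euler factor at most
  exp(1/2^(k+1)), so together they contribute at most \<open>exp 1\<close>.\<close>

lemma prod_euler_factor_le_card_powr:
  fixes \<epsilon> :: real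
  assumes eps: "\<epsilon> > 0"
  shows "\<exists>C>0. \<forall>B. finite B \<longrightarrow> (\<forall>p\<in>B. prime p) \<longrightarrow>
    (\<Prod>p\<in>B. euler_factor p) \<le> C * real (Suc (card B)) powr \<epsilon>"
proof -
  from prod_euler_factor_dyadic_le[OF eps] obtain C where C: "C > 0"
    "\<And>k. (\<Prod>p\<in>{p::nat. prime p \<and> p \<le> 2 ^ k}. euler_factor p) \<le> C * 2 powr (\<epsilon> * real k)" by blast
  have "(\<Prod>p\<in>B. euler_factor p) \<le> (C * 2 powr \<epsilon> * exp 1) * real (Suc (card B)) powr \<epsilon>"
    if B: "finite B" "\<forall>p\<in>B. prime p" for B
  proof -
    obtain k :: nat where k: "2 ^ k \<le> Suc (card B)" "Suc (card B) < 2 ^ Suc k"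
      using ex_power_ivl1[of 2 "Suc (card B)"] by auto
    let ?P = "{p::nat. prime p \<and> p \<le> 2 ^ Suc k}"
    let ?B = "{p\<in>B. 2 ^ Suc k < p}"
    have finP: "finite ?P" by (rule finite_subset[of _ "{..2 ^ Suc k}"]) auto
    have ge: "euler_factor p \<ge> 0" if "prime p" for p
      using euler_factor_ge_1[OF that] by simp
    \<comment> \<open>Adding all primes up to 2^(k+1) can only increase the product, since each
      factor is at least 1.\<close>
    have "(\<Prod>p\<in>B. euler_factor p) \<le> (\<Prod>p\<in>?P \<union> ?B. euler_factor p)"
      using B finP by (intro prod_mono2) (auto simp: euler_factor_ge_1 ge)
    also have "\<dots> = (\<Prod>p\<in>?P. euler_factor p) * (\<Prod>p\<in>?B. euler_factor p)"
      using B finP by (intro prod.union_disjoint) auto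
    also have "\<dots> \<le> (C * 2 powr (\<epsilon> * real (Suc k))) * exp 1"
    proof (intro mult_mono C(2))
      have "(\<Prod>p\<in>?B. euler_factor p) \<le> exp (real (card ?B) / real (2 ^ Suc k))"
        using B by (intro prod_euler_factor_large) auto
      also have "card ?B \<le> card B" using B by (intro card_mono) auto
      then have "real (card ?B) \<le> real (2 ^ Suc k)" using k by linarith
      then have "real (card ?B) / real (2 ^ Suc k) \<le> 1" by (simp only: divide_le_eq_1) simp
      then have "exp (real (card ?B) / real (2 ^ Suc k)) \<le> exp 1" by simp
      finally show "(\<Prod>p\<in>?B. euler_factor p) \<le> exp 1" .
    qed (use B C ge in \<open>auto intro!: prod_nonneg\<close>)
    also have "2 powr (\<epsilon> * real (Suc k)) = 2 powr \<epsilon> * (2 ^ k) powr \<epsilon>"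
      by (simp add: powr_powr powr_realpow[symmetric] powr_add algebra_simps)
    also have "C * (2 powr \<epsilon> * (2 ^ k) powr \<epsilon>) * exp 1 \<le> C * (2 powr \<epsilon> * real (Suc (card B)) powr \<epsilon>) * exp 1"
    proof -
      have "(2::real) ^ k \<le> real (Suc (card B))"
        using k(1) by (metis of_nat_le_iff of_nat_numeral of_nat_power)
      then show ?thesis
        using C eps by (intro mult_right_mono mult_left_mono powr_mono2) auto
    qed
    finally show ?thesis by (simp add: mult_ac)
  qed
  then show ?thesis using C(1) by (intro exI[of _ "C * 2 powr \<epsilon> * exp 1"]) auto
qed

section \<open>Chebyshev's lower bound through least common multiples\<close>

text \<open>The entries \<open>1 / ((n + 1) * binomial n k)\<close> of the Leibniz harmonic triangle are integer
  combinations of \<open>1, 1/2, \<dots>, 1/(n+1)\<close>.\<close>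

lemma leibniz_triangle_Ints:
  assumes "\<And>i. 1 \<le> i \<Longrightarrow> i \<le> Suc n \<Longrightarrow> i dvd m" "k \<le> n"
  shows "real m / (real (Suc n) * real (n choose k)) \<in> \<int>"
  using assms
proof (induction k arbitrary: n)
  case 0
  have "Suc n dvd m" using 0 by auto
  then obtain j where "m = Suc n * j" ..
  then have "real m / (real (Suc n) * real (n choose 0)) = real j"
    by (simp add: field_simps)
  then show ?case by simp
next
  case (Suc k)
  obtain n' where n: "n = Suc n'" using Suc.prems by (cases n) auto
  have k: "k \<le> n'" using Suc.prems n by simp
  have "real m / (real (Suc n') * real (n' choose k)) \<in> \<int>"
    using Suc.prems n by (intro Suc.IH) auto
  moreover have "real m / (real (Suc n) * real (n choose k)) \<in> \<int>"
    using Suc.prems by (intro Suc.IH) auto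
  \<comment> \<open>The rule of the triangle: an entry is the sum of the two adjacent entries of the
    next row.\<close>
  moreover have "real m / (real (Suc n) * real (n choose Suc k)) =
      real m / (real (Suc n') * real (n' choose k)) - real m / (real (Suc n) * real (n choose k))"
  proof -
    have a: "real (n choose k) = real (Suc n') * real (n' choose k) / (real (Suc n') - real k)"
    proof -
      have "(Suc n' - k) * (Suc n' choose k) = Suc n' * (n' choose k)"
        using binomial_absorb_comp[of "Suc n'" k] by simp
      then have "real (Suc n' - k) * real (Suc n' choose k) = real (Suc n') * real (n' choose k)"
        by (metis of_nat_mult)
      moreover have "real (Suc n' - k) = real (Suc n') - real k" using k by (simp add: of_nat_diff)
      ultimately show ?thesis using k n by (simp add: field_simps)
    qed
    have b: "real (n choose Suc k) = real (Suc n') * real (n' choose k) / real (Suc k)"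
      using arg_cong[OF Suc_times_binomial[of k n'], of real] n
      by (simp add: field_simps del: binomial_Suc_Suc)
    define x c where "x = real n'" and "c = real (n' choose k)"
    have "c > 0" "x + 1 - real k > 0" "x \<ge> 0" using k by (auto simp: x_def c_def)
    then have "real m / ((x + 2) * ((x + 1) * c / (real k + 1))) =
        real m / ((x + 1) * c) - real m / ((x + 2) * ((x + 1) * c / (x + 1 - real k)))"
      by (simp add: divide_simps) (simp add: algebra_simps)
    moreover have "real (Suc n) = x + 2" "real (Suc n') = x + 1" "real (Suc k) = real k + 1"
      by (simp_all add: x_def n)
    ultimately show ?thesis unfolding a b c_def by (simp only:)
  qed
  ultimately show ?case by simp
qed

lemma prime_power_multiplicity_Lcm_le:
  assumes "prime p" "N > 0"
  shows "p ^ multiplicity p (Lcm {1..N}) \<le> (N::nat)"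
  using assms(2)
proof (induction N rule: nat_induct_non_zero)
  case (Suc N)
  have eq: "Lcm {1..Suc N} = lcm (Suc N) (Lcm {1..N})"
    using atLeastAtMostSuc_conv[of 1 N] by (simp del: Lcm_eq_0_I_nat)
  have "Lcm {1..N} \<noteq> 0" by (auto simp: Lcm_0_iff_nat)
  then have "multiplicity p (Lcm {1..Suc N}) = max (multiplicity p (Suc N)) (multiplicity p (Lcm {1..N}))"
    unfolding eq using assms(1) by (intro multiplicity_lcm) auto
  moreover have "p ^ multiplicity p (Suc N) \<le> Suc N"
    by (intro dvd_imp_le multiplicity_dvd) simp
  ultimately show ?case using Suc.IH by (auto simp: max_def)
qed (use assms in simp)

lemma finite_primes_upto [simp]: "finite (primes_upto N)"
  by (simp add: primes_upto_def)

text \<open>In the prime factorization only primes up to \<open>N\<close> occur, and each prime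
  power is at most \<open>N\<close>.\<close>

lemma Lcm_le_power_primes: "N > 0 \<Longrightarrow> Lcm {1..N} \<le> N ^ card (primes_upto N)" for N :: nat
proof -
  assume N: "N > 0"
  let ?L = "Lcm {1..N}"
  have L0: "?L \<noteq> 0" by (auto simp: Lcm_0_iff_nat)
  have pf: "prime_factors ?L \<subseteq> primes_upto N"
  proof
    fix p assume p: "p \<in> prime_factors ?L"
    then have pp: "prime p" by auto
    have "multiplicity p ?L > 0" using p L0 by (simp add: prime_factors_multiplicity)
    then have "p ^ 1 \<le> p ^ multiplicity p ?L"
      using pp by (intro power_increasing) (auto simp: prime_gt_0_nat Suc_le_eq)
    also have "\<dots> \<le> N" by (rule prime_power_multiplicity_Lcm_le[OF pp N])
    finally show "p \<in> primes_upto N"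
      using pp prime_ge_1_nat[OF pp] by (simp add: primes_upto_def)
  qed
  have "?L = (\<Prod>p\<in>prime_factors ?L. p ^ multiplicity p ?L)"
    using prod_prime_factors[OF L0] by simp
  also have "\<dots> \<le> (\<Prod>p\<in>prime_factors ?L. N)"
    using N prime_power_multiplicity_Lcm_le by (intro prod_mono) (auto simp: in_prime_factors_iff)
  also have "\<dots> \<le> N ^ card (primes_upto N)"
    using N pf by (simp add: card_mono power_increasing)
  finally show ?thesis .
qed

text \<open>The least common multiple times the middle entry of row 2n of the Leibniz triangle is a
  positive integer. Hence it is at least (2n+1) times the central binomial coefficient, thus at
  least 4^n, while \<open>Lcm_le_power_primes\<close> bounds it above. Then take logarithms.\<close>

lemma chebyshev_lower:
  assumes "N \<ge> 2"
  shows "real N \<le> 8 * real (card (primes_upto N)) * ln (real N)"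
proof (cases "N \<ge> 4")
  case True
  \<comment> \<open>The largest \<open>n\<close> with 2n + 1 \<le> N.\<close>
  define n where "n = (N - 1) div 2"
  have n0: "n > 0" and nN: "2 * n + 1 \<le> N" "N \<le> 2 * n + 2" using True by (auto simp: n_def)
  have N0: "N > 0" using assms by simp
  let ?L = "Lcm {1..N}"
  have L0: "?L \<noteq> 0" by (auto simp: Lcm_0_iff_nat)
  have Lpos: "real ?L > 0" using L0 unfolding of_nat_0_less_iff by (rule neq0_conv[THEN iffD1])
  have "real ?L / (real (Suc (2 * n)) * real ((2 * n) choose n)) \<in> \<int>"
    using nN by (intro leibniz_triangle_Ints dvd_Lcm) auto
  then obtain j :: int where j: "real ?L / (real (Suc (2 * n)) * real ((2 * n) choose n)) = of_int j"
    by (auto elim: Ints_cases)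
  have "real ?L / (real (Suc (2 * n)) * real ((2 * n) choose n)) > 0"
    using Lpos by (intro divide_pos_pos mult_pos_pos) simp_all
  then have "j \<ge> 1" using j by simp
  then have "real ?L / (real (Suc (2 * n)) * real ((2 * n) choose n)) \<ge> 1" using j by simp
  moreover have "real (Suc (2 * n)) * real ((2 * n) choose n) > 0" by simp
  ultimately have "real (Suc (2 * n)) * real ((2 * n) choose n) \<le> real ?L"
    by (simp add: le_divide_eq_1_pos)
  moreover have "4 ^ n \<le> real (Suc (2 * n)) * real ((2 * n) choose n)"
  proof -
    have "4 ^ n = (2 * real n) * (4 ^ n / (2 * real n))" using n0 by simp
    also have "\<dots> \<le> real (Suc (2 * n)) * real ((2 * n) choose n)"
      using central_binomial_lower_bound[OF n0] by (intro mult_mono) auto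
    finally show ?thesis .
  qed
  moreover have "real ?L \<le> real N ^ card (primes_upto N)"
    using Lcm_le_power_primes[OF N0] by (metis of_nat_le_iff of_nat_power)
  ultimately have "4 ^ n \<le> real N ^ card (primes_upto N)" by linarith
  then have "ln (4 ^ n) \<le> ln (real N ^ card (primes_upto N))"
    using N0 by (subst ln_le_cancel_iff) auto
  then have "real n * ln 4 \<le> real (card (primes_upto N)) * ln (real N)"
    using N0 by (simp add: ln_realpow)
  moreover have "ln (4::real) \<ge> 1"
    using exp_le by (subst ln_ge_iff) auto
  then have "real n * 1 \<le> real n * ln 4" by (intro mult_left_mono) auto
  moreover have "real N \<le> 8 * real n" using nN n0 by linarith
  ultimately show ?thesis by linarith
next
  case False
  \<comment> \<open>For N = 2 or 3 the prime 2 alone suffices: ln N \<ge> 1/2 makes the right-hand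
    side at least 4.\<close>
  then have "2 \<in> primes_upto N" using assms by (auto simp: primes_upto_def)
  then have "card (primes_upto N) \<ge> 1"
    by (metis One_nat_def Suc_leI card_gt_0_iff empty_iff finite_primes_upto)
  moreover have "ln (real N) \<ge> 1 / 2"
  proof -
    have "exp (1/2::real) ^ 2 \<le> 2 ^ 2"
      using exp_le by (simp add: power2_eq_square exp_add [symmetric])
    then have "exp (1/2::real) \<le> 2" by (rule power2_le_imp_le) simp
    then have "exp (1/2) \<le> real N" using assms by linarith
    then show ?thesis using assms by (subst ln_ge_iff) auto
  qed
  ultimately have "1 * (1 / 2) \<le> real (card (primes_upto N)) * ln (real N)"
    by (intro mult_mono) auto
  then show ?thesis using False by simp
qed

section \<open>The large sieve inequality\<close>

definition trig :: "nat set \<Rightarrow> (nat \<Rightarrow> complex) \<Rightarrow> real \<Rightarrow> complex" where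
  "trig A a x = (\<Sum>n\<in>A. a n * e (real n * x))"

text \<open>Applied to n x with n \<le> N and |x| \<le> 1/(6N), where it rules out cancellation: for
  the weights in \<open>large_sieve\<close> and for the majorant in
  \<open>integral_trig_one_ge\<close>.\<close>

lemma Re_e_ge_half:
  assumes "\<bar>x\<bar> \<le> 1 / 6"
  shows "Re (e x) \<ge> 1 / 2"
proof -
  have "\<bar>2 * pi * x\<bar> = 2 * pi * \<bar>x\<bar>" by (simp add: abs_mult)
  also have "\<dots> \<le> 2 * pi * (1 / 6)" using assms by (intro mult_left_mono) auto
  finally have "cos (pi / 3) \<le> cos \<bar>2 * pi * x\<bar>"
    by (intro cos_monotone_0_pi_le) auto
  then show ?thesis by (simp add: e_eq_cis cos_60)
qed

section \<open>Exponential sums and their mean squares\<close>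

lemma continuous_on_e [continuous_intros]:
  "continuous_on S f \<Longrightarrow> continuous_on S (\<lambda>x. e (f x))"
  unfolding e_def by (intro continuous_intros)

lemma continuous_on_trig [continuous_intros]:
  "continuous_on S f \<Longrightarrow> continuous_on S (\<lambda>x. trig A a (f x))"
  unfolding trig_def by (intro continuous_intros)

lemma trig_add_int: "trig A a (x + of_int m) = trig A a x"
proof -
  have "e (real n * (x + of_int m)) = e (real n * x)" for n
  proof -
    have "e (real n * of_int m) = 1" by (simp add: e_eq_1_iff)
    then show ?thesis by (simp add: distrib_left e_add)
  qed
  then show ?thesis by (simp add: trig_def)
qed

lemma has_integral_e:
  fixes k u v :: int
  assumes "u \<le> v"
  shows "((\<lambda>x. e (of_int k * x)) has_integral (if k = 0 then of_int (v - u) else 0)) {of_int u..of_int v}"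
proof (cases "k = 0")
  case True
  then show ?thesis
    using has_integral_const_real[of "1::complex" "of_int u" "of_int v"] assms
    by (simp add: e_def scaleR_conv_of_real)
next
  case False
  define F where "F = (\<lambda>x. e (of_int k * x) / (2 * pi * \<i> * of_int k))"
  have "((\<lambda>x. e (of_int k * x)) has_integral (F (of_int v) - F (of_int u))) {of_int u..of_int v}"
  proof (rule fundamental_theorem_of_calculus)
    fix x :: real
    have "((\<lambda>z. exp (2 * pi * \<i> * (of_int k * z)) / (2 * pi * \<i> * of_int k)) has_field_derivative
      exp (2 * pi * \<i> * (of_int k * of_real x))) (at (of_real x))"
      using False by (auto intro!: derivative_eq_intros)
    from has_vector_derivative_real_field[OF this]
    show "(F has_vector_derivative e (of_int k * x)) (at x within {of_int u..of_int v})"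
      by (simp add: F_def e_def mult_ac)
  qed (use assms in simp)
  moreover have "F (of_int v) = F (of_int u)"
    using e_eq_1_iff[of "of_int k * of_int v"] e_eq_1_iff[of "of_int k * of_int u"] by (simp add: F_def)
  ultimately show ?thesis using False by simp
qed

text \<open>Orthogonality leaves only the diagonal of the expanded square. Several periods are
  allowed because the intervals around points of [0,1) in \<open>large_sieve\<close> reach into the
  neighbouring periods.\<close>

lemma parseval_trig:
  fixes u v :: int
  assumes "finite A" "u \<le> v"
  shows "((\<lambda>x. norm (trig A a x) ^ 2) has_integral of_int (v - u) * (\<Sum>n\<in>A. norm (a n) ^ 2))
    {of_int u..of_int v}"
proof -
  have "((\<lambda>x. \<Sum>n\<in>A. \<Sum>m\<in>A. a n * cnj (a m) * e (of_int (int n - int m) * x)) has_integral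
     (\<Sum>n\<in>A. \<Sum>m\<in>A. a n * cnj (a m) * (if int n - int m = 0 then of_int (v - u) else 0)))
     {of_int u..of_int v}"
    by (intro has_integral_sum assms has_integral_mult_right has_integral_e)
  moreover have "(\<Sum>n\<in>A. \<Sum>m\<in>A. a n * cnj (a m) * e (of_int (int n - int m) * x)) =
      of_real (norm (trig A a x) ^ 2)" for x
  proof -
    have "e (of_int (int n - int m) * x) = e (real n * x) * cnj (e (real m * x))" for n m
      by (simp add: cnj_e e_add [symmetric] algebra_simps)
    then show ?thesis
      unfolding complex_norm_square trig_def cnj_sum sum_product
      by (simp add: mult_ac)
  qed
  moreover have "(\<Sum>n\<in>A. \<Sum>m\<in>A. a n * cnj (a m) * (if int n - int m = 0 then of_int (v - u) else 0))
      = of_real (of_int (v - u) * (\<Sum>n\<in>A. norm (a n) ^ 2))"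
  proof -
    have "(\<Sum>m\<in>A. a n * cnj (a m) * (if int n - int m = 0 then of_int (v - u) else 0)) =
        of_int (v - u) * of_real (norm (a n) ^ 2)" if "n \<in> A" for n
    proof -
      have "(\<Sum>m\<in>A. a n * cnj (a m) * (if int n - int m = 0 then of_int (v - u) else 0)) =
        (\<Sum>m\<in>A. if n = m then a n * cnj (a m) * of_int (v - u) else 0)"
        by (intro sum.cong) auto
      also have "\<dots> = a n * cnj (a n) * of_int (v - u)"
        using assms(1) that by simp
      finally show ?thesis by (simp only: complex_norm_square mult_ac)
    qed
    then show ?thesis by (simp add: sum_distrib_left)
  qed
  ultimately have "((\<lambda>x. complex_of_real (norm (trig A a x) ^ 2)) has_integral
      of_real (of_int (v - u) * (\<Sum>n\<in>A. norm (a n) ^ 2))) {of_int u..of_int v}"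
    by (simp only:)
  from has_integral_linear[OF this bounded_linear_Re] show ?thesis
    by (simp add: o_def)
qed

text \<open>Cauchy-Schwarz, from the nonnegativity of the integral of (g - m)^2 with
  \<open>m\<close> the mean of \<open>g\<close>.\<close>

lemma integral_square_le:
  fixes g :: "real \<Rightarrow> real"
  assumes "continuous_on {a..b} g" "a < b"
  shows "(integral {a..b} g)\<^sup>2 \<le> (b - a) * integral {a..b} (\<lambda>x. (g x)\<^sup>2)"
proof -
  define m where "m = integral {a..b} g / (b - a)"
  have ig: "g integrable_on {a..b}" and ig2: "(\<lambda>x. (g x)\<^sup>2) integrable_on {a..b}"
    using assms by (auto intro!: integrable_continuous_real continuous_intros)
  have "((\<lambda>x. (g x)\<^sup>2 - 2 * m * g x + m\<^sup>2) has_integral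
      (integral {a..b} (\<lambda>x. (g x)\<^sup>2) - 2 * m * integral {a..b} g + (b - a) * m\<^sup>2)) {a..b}"
    using has_integral_const_real[of "m\<^sup>2" a b] assms(2)
    by (intro has_integral_add has_integral_diff has_integral_mult_right integrable_integral ig ig2) auto
  then have "integral {a..b} (\<lambda>x. (g x)\<^sup>2) - 2 * m * integral {a..b} g + (b - a) * m\<^sup>2 \<ge> 0"
  proof (rule has_integral_nonneg)
    fix x
    have "(g x)\<^sup>2 - 2 * m * g x + m\<^sup>2 = (g x - m)\<^sup>2" by (simp add: power2_eq_square algebra_simps)
    then show "0 \<le> (g x)\<^sup>2 - 2 * m * g x + m\<^sup>2" by simp
  qed
  moreover have "integral {a..b} g = m * (b - a)" using assms(2) by (simp add: m_def)
  ultimately have "(b - a) * m\<^sup>2 \<le> integral {a..b} (\<lambda>x. (g x)\<^sup>2)"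
    by (simp add: power2_eq_square algebra_simps)
  then have "(b - a) * ((b - a) * m\<^sup>2) \<le> (b - a) * integral {a..b} (\<lambda>x. (g x)\<^sup>2)"
    using assms(2) by (intro mult_left_mono) auto
  then show ?thesis using \<open>integral {a..b} g = m * (b - a)\<close>
    by (simp add: power2_eq_square mult_ac)
qed

text \<open>Each point lies in at most one interval, so the restrictions of \<open>g\<close> to the
  intervals add up to at most \<open>g\<close>.\<close>

lemma sum_integral_disjoint_le:
  fixes g :: "real \<Rightarrow> real"
  assumes "finite I" "continuous_on {c..d} g" "\<And>x. g x \<ge> 0"
    and "\<And>i. i \<in> I \<Longrightarrow> {l i..r i} \<subseteq> {c..d}"
    and "\<And>i j. i \<in> I \<Longrightarrow> j \<in> I \<Longrightarrow> i \<noteq> j \<Longrightarrow> {l i..r i} \<inter> {l j..r j} = {}"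
  shows "(\<Sum>i\<in>I. integral {l i..r i} g) \<le> integral {c..d} g"
proof -
  have int: "g integrable_on {c..d}"
    using assms(2) by (rule integrable_continuous_real)
  have "((\<lambda>x. if x \<in> {l i..r i} then g x else 0) has_integral integral {l i..r i} g) {c..d}"
    if "i \<in> I" for i
  proof -
    have "(g has_integral integral {l i..r i} g) {l i..r i}"
      using assms(2,4) that by (intro integrable_integral integrable_continuous_real)
        (blast intro: continuous_on_subset)
    then show ?thesis
      using has_integral_restrict[OF assms(4)[OF that]] by blast
  qed
  then have "((\<lambda>x. \<Sum>i\<in>I. if x \<in> {l i..r i} then g x else 0) has_integral
      (\<Sum>i\<in>I. integral {l i..r i} g)) {c..d}"
    using assms(1) by (intro has_integral_sum)
  moreover have "(g has_integral integral {c..d} g) {c..d}"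
    using int by (rule integrable_integral)
  ultimately show ?thesis
  proof (rule has_integral_le)
    fix x
    show "(\<Sum>i\<in>I. if x \<in> {l i..r i} then g x else 0) \<le> g x"
    proof (cases "\<exists>j\<in>I. x \<in> {l j..r j}")
      case True
      then obtain j where j: "j \<in> I" "x \<in> {l j..r j}" by auto
      have "(\<Sum>i\<in>I. if x \<in> {l i..r i} then g x else 0) = (\<Sum>i\<in>I. if i = j then g x else 0)"
        using assms(5) j by (intro sum.cong refl) (smt (verit) IntI empty_iff)
      then show ?thesis using j assms(1) by simp
    next
      case False
      then have "(\<Sum>i\<in>I. if x \<in> {l i..r i} then g x else 0) = (\<Sum>i\<in>I. 0)"
        by (intro sum.cong) auto
      then show ?thesis using assms(3) by simp
    qed
  qed
qed

text \<open>Each value \<open>trig A a x\<close> is the integral over \<open>[x - h, x + h]\<close> of another trigonometric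
  polynomial with frequencies in \<open>A\<close>; for disjoint intervals Parseval applies.\<close>

lemma large_sieve:
  assumes N: "N \<ge> 1" and A: "A \<subseteq> {1..N}" and I: "finite I"
    and x: "\<And>i. i \<in> I \<Longrightarrow> 0 \<le> x i \<and> x i < 1"
    and sep: "\<And>i j. i \<in> I \<Longrightarrow> j \<in> I \<Longrightarrow> i \<noteq> j \<Longrightarrow> \<bar>x i - x j\<bar> \<ge> 1 / (2 * real N)"
  shows "(\<Sum>i\<in>I. norm (trig A a (x i)) ^ 2) \<le> 36 * real N * (\<Sum>n\<in>A. norm (a n) ^ 2)"
proof -
  \<comment> \<open>Small enough that |n u| \<le> 1/6 for n \<le> N and |u| \<le> h, and that 2h <
    1/(2N), so that intervals of radius \<open>h\<close> around separated points are
    disjoint.\<close>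
  define h where "h = 1 / (6 * real N)"
  have h0: "h > 0" and h1: "h < 1" using N by (auto simp: h_def field_simps)
  have finA: "finite A" using A finite_subset by blast
  define w where "w = (\<lambda>n::nat. integral {-h..h} (\<lambda>u. e (real n * u)))"
  have ie: "(\<lambda>u. e (real n * u)) integrable_on {-h..h}" for n
    by (intro integrable_continuous_real continuous_intros)
  have w: "norm (w n) \<ge> h" if "n \<in> A" for n
  proof -
    have nN: "real n \<le> real N" using that A by auto
    have "((\<lambda>u. Re (e (real n * u))) has_integral Re (w n)) {-h..h}"
      using has_integral_linear[OF integrable_integral[OF ie[of n]] bounded_linear_Re]
      by (simp add: o_def w_def)
    moreover have "((\<lambda>u. 1 / 2) has_integral h) {-h..h}"
      using has_integral_const_real[of "1/2::real" "-h" h] h0 by simp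
    moreover have "1 / 2 \<le> Re (e (real n * u))" if "u \<in> {-h..h}" for u
    proof (rule Re_e_ge_half)
      have "\<bar>real n * u\<bar> \<le> real N * h"
        unfolding abs_mult using that nN h0 by (intro mult_mono) auto
      then show "\<bar>real n * u\<bar> \<le> 1 / 6" using N by (simp add: h_def)
    qed
    ultimately have "h \<le> Re (w n)" by (blast intro: has_integral_le)
    then show ?thesis using complex_Re_le_cmod[of "w n"] by linarith
  qed
  \<comment> \<open>Integrating e(n s) over [t - h, t + h] gives e(n t) times \<open>w n\<close>;
    dividing the coefficients by \<open>w n\<close> makes the integral reproduce
    \<open>trig A a t\<close>.\<close>
  define b where "b = (\<lambda>n. a n / w n)"
  have rep: "norm (trig A a t) ^ 2 \<le> 2 * h * integral {t - h..t + h} (\<lambda>s. norm (trig A b s) ^ 2)" for t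
  proof -
    have "((\<lambda>u. \<Sum>n\<in>A. b n * e (real n * t) * e (real n * u)) has_integral
        (\<Sum>n\<in>A. b n * e (real n * t) * w n)) {-h..h}"
      unfolding w_def using finA ie by (intro has_integral_sum has_integral_mult_right integrable_integral)
    moreover have "(\<Sum>n\<in>A. b n * e (real n * t) * w n) = trig A a t"
      unfolding trig_def using w h0 by (intro sum.cong refl) (force simp: b_def)
    moreover have "(\<Sum>n\<in>A. b n * e (real n * t) * e (real n * u)) = trig A b (u + t)" for u
      by (simp add: trig_def distrib_left e_add mult_ac)
    ultimately have "integral {-h..h} (\<lambda>u. trig A b (u + t)) = trig A a t"
      by (simp add: integral_unique)
    moreover have i1: "(\<lambda>u. trig A b (u + t)) integrable_on {-h..h}"
      and i2: "(\<lambda>u. norm (trig A b (u + t))) integrable_on {-h..h}"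
      by (intro integrable_continuous_real continuous_intros)+
    ultimately have "norm (trig A a t) \<le> integral {-h..h} (\<lambda>u. norm (trig A b (u + t)))"
      by (metis (mono_tags, lifting) i1 i2 integral_norm_bound_integral order_refl)
    then have "norm (trig A a t) ^ 2 \<le> (integral {-h..h} (\<lambda>u. norm (trig A b (u + t))))\<^sup>2"
      by (intro power_mono) auto
    also have "\<dots> \<le> (h - (- h)) * integral {-h..h} (\<lambda>u. (norm (trig A b (u + t)))\<^sup>2)"
      using h0 by (intro integral_square_le continuous_intros) auto
    also have "integral {-h..h} (\<lambda>u. (norm (trig A b (u + t)))\<^sup>2) =
        integral {-h + t..h + t} (\<lambda>s. (norm (trig A b s))\<^sup>2)"
      using integral_shift[of "-h" t h "\<lambda>s. (norm (trig A b s))\<^sup>2"]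
      by (simp add: o_def continuous_intros)
    finally show ?thesis by (simp add: algebra_simps)
  qed
  have "(\<Sum>i\<in>I. norm (trig A a (x i)) ^ 2) \<le>
      (\<Sum>i\<in>I. 2 * h * integral {x i - h..x i + h} (\<lambda>s. norm (trig A b s) ^ 2))"
    by (intro sum_mono rep)
  also have "\<dots> = 2 * h * (\<Sum>i\<in>I. integral {x i - h..x i + h} (\<lambda>s. norm (trig A b s) ^ 2))"
    by (simp add: sum_distrib_left)
  also have "\<dots> \<le> 2 * h * integral {-1..2} (\<lambda>s. norm (trig A b s) ^ 2)"
  proof (intro mult_left_mono sum_integral_disjoint_le I)
    fix i assume "i \<in> I"
    then show "{x i - h..x i + h} \<subseteq> {-1..2}" using x[of i] h1 by auto
  next
    fix i j assume "i \<in> I" "j \<in> I" "i \<noteq> j"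
    moreover have "1 / (2 * real N) > 2 * h" using N by (simp add: h_def field_simps)
    ultimately show "{x i - h..x i + h} \<inter> {x j - h..x j + h} = {}"
      using sep[of i j] by auto
  qed (use h0 in \<open>auto intro!: continuous_intros\<close>)
  also have "integral {-1..2} (\<lambda>s. norm (trig A b s) ^ 2) = 3 * (\<Sum>n\<in>A. norm (b n) ^ 2)"
    using parseval_trig[OF finA, of "-1" 2 b] by (simp add: integral_unique)
  also have "2 * h * (3 * (\<Sum>n\<in>A. norm (b n) ^ 2)) \<le> 2 * h * (3 * (\<Sum>n\<in>A. norm (a n) ^ 2 / h ^ 2))"
  proof -
    have "norm (b n) ^ 2 \<le> norm (a n) ^ 2 / h ^ 2" if "n \<in> A" for n
    proof -
      have "norm (b n) \<le> norm (a n) / h"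
        unfolding b_def norm_divide using w[OF that] h0 by (intro divide_left_mono mult_pos_pos) auto
      then have "norm (b n) ^ 2 \<le> (norm (a n) / h) ^ 2" by (intro power_mono) auto
      then show ?thesis by (simp add: power_divide)
    qed
    then show ?thesis using h0 by (intro mult_left_mono sum_mono) auto
  qed
  \<comment> \<open>Here 2h * 3 / h^2 = 6/h = 36 N, where 3 is the number of periods in
    [-1, 2].\<close>
  also have "\<dots> = 36 * real N * (\<Sum>n\<in>A. norm (a n) ^ 2)"
  proof -
    have "2 * h * (3 * (S / h ^ 2)) = 36 * real N * S" for S
      using N by (simp add: h_def power2_eq_square)
    then show ?thesis by (simp only: sum_divide_distrib [symmetric])
  qed
  finally show ?thesis .
qed

text \<open>Summing over the shifts k/q multiplies the coefficient at \<open>n\<close> by a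
  Ramanujan sum, the same unimodular number for all frequencies in \<open>A\<close>. Then
  Cauchy-Schwarz over the \<phi>(q) shifts.\<close>

lemma trig_square_le_sum_shifts:
  assumes q: "squarefree q" and cop: "\<And>n. n \<in> A \<Longrightarrow> coprime n q"
  shows "norm (trig A a t) ^ 2 \<le>
    real (totient q) * (\<Sum>k\<in>totatives q. norm (trig A a (t + real k / real q)) ^ 2)"
proof -
  obtain s where s: "norm s = 1"
    "\<And>n. coprime n q \<Longrightarrow> (\<Sum>k\<in>totatives q. e (real k * real n / real q)) = s"
    using ramanujan_sum_squarefree[OF q] by blast
  have "(\<Sum>k\<in>totatives q. trig A a (t + real k / real q)) =
      (\<Sum>n\<in>A. \<Sum>k\<in>totatives q. a n * e (real n * t) * e (real k * real n / real q))"
    unfolding trig_def by (subst sum.swap) (simp add: distrib_left e_add mult_ac)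
  also have "\<dots> = (\<Sum>n\<in>A. a n * e (real n * t) * s)"
    using s(2) cop by (simp add: sum_distrib_left [symmetric])
  also have "\<dots> = trig A a t * s" by (simp add: trig_def sum_distrib_right)
  finally have "norm (trig A a t) = norm (\<Sum>k\<in>totatives q. trig A a (t + real k / real q))"
    using s(1) by (simp add: norm_mult)
  also have "\<dots> \<le> (\<Sum>k\<in>totatives q. norm (trig A a (t + real k / real q)))" by (rule norm_sum)
  finally have "norm (trig A a t) ^ 2 \<le> (\<Sum>k\<in>totatives q. norm (trig A a (t + real k / real q))) ^ 2"
    by (intro power_mono) auto
  also have "\<dots> \<le> (\<Sum>k\<in>totatives q. norm (trig A a (t + real k / real q)) ^ 2) * real (card (totatives q))"
    by (rule sum_squared_le_sum_of_squares)
  finally show ?thesis by (simp add: totient_def mult.commute)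
qed

section \<open>The large sieve for well-spaced points and primes\<close>

text \<open>All rationals with denominators at most \<open>D\<close> that are close to \<open>t\<close> coincide, and their common
  reduced denominator is not 1.\<close>

lemma common_prime_of_near_rationals:
  fixes t :: real
  assumes N: "N \<ge> 1" and D: "D ^ 2 \<le> N"
    and far: "\<And>m::int. \<bar>t - of_int m\<bar> \<ge> 1 / (2 * real N)"
  shows "\<exists>p. prime p \<and>
    (\<forall>(c::int) d. 1 \<le> d \<longrightarrow> d \<le> D \<longrightarrow> \<bar>t - of_int c / real d\<bar> < 1 / (2 * real N) \<longrightarrow> p dvd d)"
proof (cases "\<exists>(c::int) d. 1 \<le> d \<and> d \<le> D \<and> \<bar>t - of_int c / real d\<bar> < 1 / (2 * real N)")
  case False
  \<comment> \<open>No rational is close, so the condition is vacuous and any prime serves.\<close>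
  then show ?thesis by (intro exI[of _ 2]) auto
next
  case True
  then obtain c0 d0 where c0: "1 \<le> d0" "d0 \<le> D" "\<bar>t - of_int c0 / real d0\<bar> < 1 / (2 * real N)"
    by blast
  \<comment> \<open>Two such fractions differ by less than 1/N, but distinct fractions with
    denominators up to \<open>D\<close> differ by at least 1/D^2 \<ge> 1/N.\<close>
  have cross: "c * int d0 = c0 * int d"
    if "1 \<le> d" "d \<le> D" "\<bar>t - of_int c / real d\<bar> < 1 / (2 * real N)" for c d
  proof -
    have "\<bar>of_int c / real d - of_int c0 / real d0\<bar> < 1 / (2 * real N) + 1 / (2 * real N)"
      using that(3) c0(3) by linarith
    then have "\<bar>of_int c / real d - of_int c0 / real d0\<bar> < 1 / real N" by simp
    moreover have "of_int c / real d - of_int c0 / real d0 =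
        of_int (c * int d0 - c0 * int d) / (real d * real d0)"
      using that(1) c0(1) by (simp add: field_simps)
    ultimately have "\<bar>of_int (c * int d0 - c0 * int d)\<bar> / (real d * real d0) < 1 / real N"
      by (simp only: abs_divide) simp
    then have "\<bar>of_int (c * int d0 - c0 * int d)\<bar> * real N < real d * real d0"
      using that(1) c0(1) N by (simp add: divide_simps mult_ac)
    also have "real d * real d0 \<le> real D * real D"
      using that c0 by (intro mult_mono) auto
    also have "\<dots> \<le> real N"
      using D by (metis of_nat_le_iff of_nat_mult power2_eq_square)
    finally have "\<bar>of_int (c * int d0 - c0 * int d)\<bar> < (1::real)"
      using N by (simp add: mult_less_cancel_right1)
    then have "\<bar>c * int d0 - c0 * int d\<bar> < 1" by linarith
    then show ?thesis by simp
  qed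
  define g where "g = gcd c0 (int d0)"
  have g0: "g > 0" using c0(1) by (simp add: g_def)
  obtain c1 d1 where c1: "c0 = c1 * g" "int d0 = d1 * g" "coprime c1 d1"
    using gcd_coprime_exists[of c0 "int d0"] g0 unfolding g_def by (metis less_irrefl)
  have d1: "d1 > 0" using c1(2) g0 c0(1)
    by (metis of_nat_0_less_iff le_eq_less_or_eq less_le_trans zero_less_mult_pos2 zero_less_one)
  \<comment> \<open>Reduced denominator 1 would place \<open>t\<close> within 1/(2N) of the integer
    \<open>c1\<close>, against \<open>far\<close>.\<close>
  have "d1 \<noteq> 1"
  proof
    assume "d1 = 1"
    then have "of_int c0 / real d0 = of_int c1"
      using c1 g0 by (metis nonzero_mult_div_cancel_right mult_1 of_int_eq_0_iff of_int_mult of_int_of_nat_eq order_less_irrefl)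
    then show False using c0(3) far[of c1] by simp
  qed
  then have "nat d1 \<noteq> 1" using d1 by simp
  then obtain p where p: "prime p" "p dvd nat d1" using prime_factor_nat by blast
  have "p dvd d" if "1 \<le> d" "d \<le> D" "\<bar>t - of_int c / real d\<bar> < 1 / (2 * real N)" for c d
  proof -
    have "(c * d1) * g = (c1 * int d) * g" using cross[OF that] c1 by (simp add: mult_ac)
    then have "c * d1 = c1 * int d" using g0 by simp
    then have "d1 dvd c1 * int d" by (metis dvd_triv_right)
    then have "d1 dvd int d" using c1(3) by (metis coprime_commute coprime_dvd_mult_right_iff)
    then have "nat d1 dvd d" using d1 by (simp add: nat_dvd_iff)
    then show ?thesis using p(2) by (rule dvd_trans[rotated])
  qed
  then show ?thesis using p(1) by blast
qed

text \<open>Distance is measured in \<real>/\<int>: with the integer \<open>m\<close> quantified,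
  the points may be arbitrary real representatives.\<close>

definition separated :: "real \<Rightarrow> 'i set \<Rightarrow> ('i \<Rightarrow> real) \<Rightarrow> bool" where
  "separated r I \<theta> \<longleftrightarrow> (\<forall>i\<in>I. \<forall>j\<in>I. i \<noteq> j \<longrightarrow> (\<forall>m::int. \<bar>\<theta> i - \<theta> j - of_int m\<bar> \<ge> r))"

lemma separated_subset: "separated r I \<theta> \<Longrightarrow> J \<subseteq> I \<Longrightarrow> separated r J \<theta>"
  unfolding separated_def by blast

text \<open>If two shifted points are close, \<theta> i - \<theta> j is near a fraction with
  denominator q r \<le> Q^2. For i \<noteq> j a prime of \<open>B\<close> divides q r, although q
  and r avoid \<open>B\<close>. For i = j, distinct reduced fractions with denominators up to
  \<open>Q\<close> are too far apart modulo 1. The bound \<open>Q ^ 4 \<le> N\<close> makes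
  denominators up to Q^2 admissible in \<open>common_prime_of_near_rationals\<close>.\<close>

lemma separated_rational_shifts:
  assumes N: "N \<ge> 1" and Q: "Q ^ 4 \<le> N" and I: "finite I"
    and sep: "separated (1 / (2 * real N)) I \<theta>"
  shows "\<exists>B. finite B \<and> (\<forall>p\<in>B. prime p) \<and> card B \<le> card I ^ 2 \<and>
    separated (1 / (2 * real N)) (I \<times> (SIGMA q:squarefree_avoiding B Q. totatives q))
      (\<lambda>(i, q, k). \<theta> i + real k / real q)"
proof -
  let ?near = "\<lambda>t (c::int) d. \<bar>t - of_int c / real d\<bar> < 1 / (2 * real N)"
  have "\<exists>p. prime p \<and> (\<forall>(c::int) d. 1 \<le> d \<longrightarrow> d \<le> Q ^ 2 \<longrightarrow> ?near (\<theta> i - \<theta> j) c d \<longrightarrow> p dvd d)"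
    if "i \<in> I" "j \<in> I" "i \<noteq> j" for i j
    using sep that Q unfolding separated_def
    by (intro common_prime_of_near_rationals N) (auto simp: power_mult [symmetric])
  then obtain P where P: "\<And>i j. i \<in> I \<Longrightarrow> j \<in> I \<Longrightarrow> i \<noteq> j \<Longrightarrow> prime (P i j)"
    "\<And>i j c d. i \<in> I \<Longrightarrow> j \<in> I \<Longrightarrow> i \<noteq> j \<Longrightarrow> 1 \<le> d \<Longrightarrow> d \<le> Q ^ 2 \<Longrightarrow>
       ?near (\<theta> i - \<theta> j) c d \<Longrightarrow> P i j dvd d"
    by metis
  define B where "B = (\<lambda>(i, j). P i j) ` {(i, j) \<in> I \<times> I. i \<noteq> j}"
  have finII: "finite {(i, j) \<in> I \<times> I. i \<noteq> j}"
    by (rule finite_subset[of _ "I \<times> I"]) (use I in auto)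
  have finB: "finite B" unfolding B_def using finII by (rule finite_imageI)
  have primeB: "\<forall>p\<in>B. prime p" using P(1) by (auto simp: B_def)
  have "card B \<le> card {(i, j) \<in> I \<times> I. i \<noteq> j}" unfolding B_def by (rule card_image_le[OF finII])
  also have "\<dots> \<le> card (I \<times> I)" using I by (intro card_mono) auto
  also have "\<dots> = card I ^ 2" by (simp add: card_cartesian_product power2_eq_square)
  finally have cardB: "card B \<le> card I ^ 2" .
  have main: "i = j \<and> q = r \<and> k = l"
    if "i \<in> I" "j \<in> I" "q \<in> squarefree_avoiding B Q" "r \<in> squarefree_avoiding B Q"
      "k \<in> totatives q" "l \<in> totatives r"
      and close: "\<bar>(\<theta> i + real k / real q) - (\<theta> j + real l / real r) - of_int m\<bar> < 1 / (2 * real N)"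
    for i j q r k l and m :: int
  proof -
    have q: "1 \<le> q" "q \<le> Q" and r: "1 \<le> r" "r \<le> Q"
      using that by (auto simp: squarefree_avoiding_def)
    have qr: "1 \<le> q * r" "q * r \<le> Q ^ 2"
      using q r mult_le_mono[OF q(2) r(2)] by (auto simp: power2_eq_square Suc_le_eq)
    \<comment> \<open>Closeness of the shifted points means that \<theta> i - \<theta> j is near
      c/(q r).\<close>
    define c where "c = int l * int q - int k * int r + m * int q * int r"
    have frac: "real k / real q - real l / real r - of_int m = - (of_int c / real (q * r))"
      using q r by (simp add: c_def field_simps)
    have near: "?near (\<theta> i - \<theta> j) c (q * r)"
      using close frac by (simp add: algebra_simps)
    have "i = j"
    proof (rule ccontr)
      assume ij: "i \<noteq> j"
      have "P i j dvd q * r" using P(2)[OF that(1,2) ij qr near] .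
      moreover have "prime (P i j)" "P i j \<in> B" using P(1) that ij by (auto simp: B_def)
      ultimately have "P i j dvd q \<or> P i j dvd r" by (simp add: prime_dvd_mult_iff)
      then show False using that(3,4) \<open>P i j \<in> B\<close> by (auto simp: squarefree_avoiding_def)
    qed
    have "\<bar>of_int c\<bar> < real (q * r) * (1 / (2 * real N))"
      using near \<open>i = j\<close> qr(1) by (simp add: abs_divide field_simps)
    also have "\<dots> \<le> real N * (1 / (2 * real N))"
    proof (rule mult_right_mono)
      have "Q ^ 2 \<le> Q ^ 4" using q by (intro power_increasing) auto
      then show "real (q * r) \<le> real N" using qr Q by linarith
    qed simp
    also have "\<dots> < 1" using N by simp
    \<comment> \<open>Thus k/q - l/r is the integer \<open>m\<close>. Coprimality yields q = r, and
      then the range \<open>1..q\<close> of the totatives forces m = 0.\<close>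
    finally have "c = 0" by linarith
    have kq: "coprime (int k) (int q)" and lr: "coprime (int l) (int r)"
      using that by (auto simp: in_totatives_iff)
    have eq1: "int k * int r = int q * (int l + m * int r)"
      using \<open>c = 0\<close> by (simp add: c_def algebra_simps)
    then have "int q dvd int k * int r" by simp
    then have "q dvd r" using kq by (metis coprime_commute coprime_dvd_mult_right_iff int_dvd_int_iff)
    have "int l * int q = int r * (int k - m * int q)"
      using \<open>c = 0\<close> by (simp add: c_def algebra_simps)
    then have "int r dvd int l * int q" by simp
    then have "r dvd q" using lr by (metis coprime_commute coprime_dvd_mult_right_iff int_dvd_int_iff)
    with \<open>q dvd r\<close> have "q = r" by (rule dvd_antisym)
    then have "int k = int l + m * int q" using eq1 q by (simp add: mult.commute)
    moreover have "0 < k" "k \<le> q" "0 < l" "l \<le> q"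
      using that \<open>q = r\<close> by (auto simp: in_totatives_iff)
    ultimately have "\<bar>m * int q\<bar> < int q" by linarith
    then have "m = 0" using q by (simp add: abs_mult mult_less_cancel_right1)
    then show ?thesis using \<open>i = j\<close> \<open>q = r\<close> \<open>int k = int l + m * int q\<close> by simp
  qed
  have "separated (1 / (2 * real N)) (I \<times> (SIGMA q:squarefree_avoiding B Q. totatives q))
      (\<lambda>(i, q, k). \<theta> i + real k / real q)"
    unfolding separated_def
  proof (intro ballI impI allI)
    fix x y and m :: int
    assume xy: "x \<in> I \<times> (SIGMA q:squarefree_avoiding B Q. totatives q)"
      "y \<in> I \<times> (SIGMA q:squarefree_avoiding B Q. totatives q)" "x \<noteq> y"
    obtain i q k j r l where [simp]: "x = (i, q, k)" "y = (j, r, l)" by (metis surj_pair)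
    show "1 / (2 * real N) \<le> \<bar>(case x of (i, q, k) \<Rightarrow> \<theta> i + real k / real q) -
        (case y of (i, q, k) \<Rightarrow> \<theta> i + real k / real q) - of_int m\<bar>"
      using main[of i j q r k l m] xy by force
  qed
  then show ?thesis using finB primeB cardB by blast
qed

text \<open>By periodicity the points may be reduced to [0,1), where separation modulo 1 implies
  ordinary separation.\<close>

lemma large_sieve_separated:
  assumes N: "N \<ge> 1" and A: "A \<subseteq> {1..N}" and I: "finite I"
    and sep: "separated (1 / (2 * real N)) I \<theta>"
  shows "(\<Sum>i\<in>I. norm (trig A a (\<theta> i)) ^ 2) \<le> 36 * real N * (\<Sum>n\<in>A. norm (a n) ^ 2)"
proof -
  have "trig A a (frac t) = trig A a t" for t
    using trig_add_int[of A a t "- \<lfloor>t\<rfloor>"] by (simp add: frac_def)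
  then have "(\<Sum>i\<in>I. norm (trig A a (\<theta> i)) ^ 2) = (\<Sum>i\<in>I. norm (trig A a (frac (\<theta> i))) ^ 2)"
    by simp
  also have "\<dots> \<le> 36 * real N * (\<Sum>n\<in>A. norm (a n) ^ 2)"
  proof (rule large_sieve[OF N A I])
    fix i j assume ij: "i \<in> I" "j \<in> I" "i \<noteq> j"
    have "frac (\<theta> i) - frac (\<theta> j) = \<theta> i - \<theta> j - of_int (\<lfloor>\<theta> i\<rfloor> - \<lfloor>\<theta> j\<rfloor>)"
      by (simp add: frac_def)
    then show "1 / (2 * real N) \<le> \<bar>frac (\<theta> i) - frac (\<theta> j)\<bar>"
      using sep ij unfolding separated_def by metis
  qed (auto simp: frac_lt_1)
  finally show ?thesis .
qed

text \<open>The sum over \<open>i\<close> is amplified by the sieve factor: by \<open>trig_square_le_sum_shifts\<close> each value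
  is controlled by the values at the shifted points \<open>\<theta> i + k / q\<close>, to all of which the large sieve
  applies at once.\<close>

lemma large_sieve_sifted:
  assumes N: "N \<ge> 1" and Q: "Q ^ 4 \<le> N" and I: "finite I"
    and sep: "separated (1 / (2 * real N)) I \<theta>"
    and A: "A \<subseteq> {1..N}" "\<And>n q. n \<in> A \<Longrightarrow> q \<in> {1..Q} \<Longrightarrow> coprime n q"
  shows "\<exists>B. finite B \<and> (\<forall>p\<in>B. prime p) \<and> card B \<le> card I ^ 2 \<and>
    ln (real (Suc Q)) * (\<Sum>i\<in>I. norm (trig A a (\<theta> i)) ^ 2) \<le>
    72 * real N * (\<Prod>p\<in>B. euler_factor p) * (\<Sum>n\<in>A. norm (a n) ^ 2)"
proof -
  obtain B where B: "finite B" "\<forall>p\<in>B. prime p" "card B \<le> card I ^ 2"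
    and sepB: "separated (1 / (2 * real N)) (I \<times> (SIGMA q:squarefree_avoiding B Q. totatives q))
      (\<lambda>(i, q, k). \<theta> i + real k / real q)"
    using separated_rational_shifts[OF N Q I sep] by blast
  let ?Z = "I \<times> (SIGMA q:squarefree_avoiding B Q. totatives q)"
  define y where "y = (\<lambda>(i, q, k). \<theta> i + real k / real q)"
  let ?H = "\<Sum>q\<in>squarefree_avoiding B Q. 1 / real (totient q)"
  let ?S = "\<Sum>i\<in>I. norm (trig A a (\<theta> i)) ^ 2"
  have finZ: "finite ?Z" using I by simp
  have "?S * ?H = (\<Sum>i\<in>I. \<Sum>q\<in>squarefree_avoiding B Q. 1 / real (totient q) * norm (trig A a (\<theta> i)) ^ 2)"
    unfolding sum_product by (simp add: mult.commute)
  also have "\<dots> \<le> (\<Sum>i\<in>I. \<Sum>q\<in>squarefree_avoiding B Q.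
      \<Sum>k\<in>totatives q. norm (trig A a (\<theta> i + real k / real q)) ^ 2)"
  proof (intro sum_mono)
    fix i q assume q: "q \<in> squarefree_avoiding B Q"
    then have q': "squarefree q" "q \<in> {1..Q}" "totient q > 0" by (auto simp: squarefree_avoiding_def)
    have "norm (trig A a (\<theta> i)) ^ 2 \<le>
      real (totient q) * (\<Sum>k\<in>totatives q. norm (trig A a (\<theta> i + real k / real q)) ^ 2)"
      using q' A(2) by (intro trig_square_le_sum_shifts) auto
    then show "1 / real (totient q) * norm (trig A a (\<theta> i)) ^ 2 \<le>
      (\<Sum>k\<in>totatives q. norm (trig A a (\<theta> i + real k / real q)) ^ 2)"
      using q'(3) by (simp add: field_simps)
  qed
  also have "\<dots> = (\<Sum>z\<in>?Z. norm (trig A a (y z)) ^ 2)"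
    by (simp add: y_def sum.cartesian_product sum.Sigma case_prod_unfold)
  also have "\<dots> \<le> 36 * real N * (\<Sum>n\<in>A. norm (a n) ^ 2)"
    using sepB unfolding y_def by (rule large_sieve_separated[OF N A(1) finZ])
  finally have SH: "?S * ?H \<le> 36 * real N * (\<Sum>n\<in>A. norm (a n) ^ 2)" .
  let ?P = "\<Prod>p\<in>B. euler_factor p"
  have P0: "?P \<ge> 0"
    using B(2) euler_factor_ge_1 by (intro prod_nonneg) (auto intro: order_trans[OF zero_le_one])
  \<comment> \<open>The sum \<open>?H\<close> is bounded below by the logarithm, at the price of the
    Euler factors of the excluded primes.\<close>
  have "ln (real (Suc Q)) * ?S \<le> (2 * ?P * ?H) * ?S"
    using ln_le_sum_inverse_totient_avoiding[OF B(1), of Q] B(2)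
    by (intro mult_right_mono sum_nonneg) auto
  also have "\<dots> = 2 * ?P * (?S * ?H)" by simp
  also have "\<dots> \<le> 2 * ?P * (36 * real N * (\<Sum>n\<in>A. norm (a n) ^ 2))"
    using SH P0 by (intro mult_left_mono) auto
  finally show ?thesis using B by (intro exI[of _ B]) (simp add: mult_ac)
qed

section \<open>Mean squares of exponential sums over primes\<close>

lemma primes_upto_subset: "primes_upto N \<subseteq> {1..N}"
  by (simp add: primes_upto_def)

lemma ex_fourth_root: "\<exists>Q::nat. Q ^ 4 \<le> N \<and> N < Suc Q ^ 4"
proof -
  define Q where "Q = (LEAST n::nat. N < Suc n ^ 4)"
  have "N < Suc N ^ 4"
    using self_le_power[of "Suc N" 4] by simp
  then have "N < Suc Q ^ 4" unfolding Q_def by (rule LeastI)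
  moreover have "Q ^ 4 \<le> N"
  proof (cases Q)
    case (Suc n)
    then have "\<not> N < Suc n ^ 4" using not_less_Least[of n "\<lambda>n. N < Suc n ^ 4"] Q_def by simp
    then show ?thesis using Suc by simp
  qed simp
  ultimately show ?thesis by blast
qed

text \<open>Primes up to \<open>Q\<close> can divide a modulus; they are few enough for the ordinary
  large sieve. For the others the gain ln(Q+1) turns N into a multiple of \<pi>(N) by Chebyshev's
  lower bound, and the excluded primes cost a constant times |I|^\<epsilon>.\<close>

lemma trig_primes_sum_squares_le:
  fixes \<epsilon> :: real
  assumes eps: "\<epsilon> > 0"
  shows "\<exists>C>0. \<forall>N\<ge>2. \<forall>a (I :: 'i set) \<theta>. (\<forall>n\<in>primes_upto N. norm (a n) \<le> 1) \<longrightarrow> finite I \<longrightarrow>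
    separated (1 / (2 * real N)) I \<theta> \<longrightarrow>
    (\<Sum>i\<in>I. norm (trig (primes_upto N) a (\<theta> i)) ^ 2) \<le>
      C * real (card (primes_upto N)) ^ 2 * real (card I) powr \<epsilon>"
proof -
  \<comment> \<open>The exponent is \<epsilon>/2 because \<open>B\<close> may have as many as |I|^2
    elements.\<close>
  obtain C where C: "C > 0" "\<And>B. finite B \<Longrightarrow> \<forall>p\<in>B. prime p \<Longrightarrow>
      (\<Prod>p\<in>B. euler_factor p) \<le> C * real (Suc (card B)) powr (\<epsilon> / 2)"
    using prod_euler_factor_le_card_powr[of "\<epsilon> / 2"] eps by auto
  define C1 where "C1 = 2304 * (C * 2 powr (\<epsilon> / 2))"
  have "(\<Sum>i\<in>I. norm (trig (primes_upto N) a (\<theta> i)) ^ 2) \<le>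
      (2 * 36864 + 2 * C1) * real (card (primes_upto N)) ^ 2 * real (card I) powr \<epsilon>"
    if N: "N \<ge> 2" and a: "\<forall>n\<in>primes_upto N. norm (a n) \<le> 1" and I: "finite I"
      and sep: "separated (1 / (2 * real N)) I \<theta>" for N a and I :: "'i set" and \<theta>
  proof (cases "I = {}")
    case False
    let ?P = "primes_upto N"
    let ?\<pi> = "real (card ?P)"
    have J1: "card I \<ge> 1" using False I by (simp add: Suc_le_eq card_gt_0_iff)
    then have Jeps: "real (card I) powr \<epsilon> \<ge> 1" using eps by (simp add: ge_one_powr_ge_zero)
    \<comment> \<open>With \<open>Q\<close> the integer part of the fourth root of \<open>N\<close>,
      ln(Q+1) is still at least a quarter of ln N.\<close>
    obtain Q where Q: "Q ^ 4 \<le> N" "N < Suc Q ^ 4" using ex_fourth_root by blast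
    have Q1: "Q \<ge> 1"
      using Q(2) N by (cases "Q = 0") auto
    have lnN: "ln (real N) > 0" using N by simp
    have lnQ: "ln (real N) \<le> 4 * ln (real (Suc Q))"
    proof -
      have "real N \<le> real (Suc Q) ^ 4"
        using Q(2) by (metis less_imp_le of_nat_le_iff of_nat_power)
      then have "ln (real N) \<le> ln (real (Suc Q) ^ 4)"
        using N by (subst ln_le_cancel_iff) auto
      also have "\<dots> = 4 * ln (real (Suc Q))" by (subst ln_realpow) auto
      finally show ?thesis .
    qed
    have cheb: "real N \<le> 8 * ?\<pi> * ln (real N)" using chebyshev_lower[OF N] .
    define A1 where "A1 = {n \<in> ?P. n \<le> Q}"
    define A2 where "A2 = {n \<in> ?P. Q < n}"
    have A1: "A1 \<subseteq> {1..N}" "finite A1" and A2: "A2 \<subseteq> {1..N}" "finite A2"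
      using primes_upto_subset by (auto simp: A1_def A2_def)
    have split: "trig ?P a t = trig A1 a t + trig A2 a t" for t
      unfolding trig_def using A1 A2
      by (subst sum.union_disjoint[symmetric]) (auto simp: A1_def A2_def intro!: sum.cong)
    have sq: "norm (a n) ^ 2 \<le> 1" if "n \<in> ?P" for n
      using a that by (simp add: power_le_one)
    have S1: "(\<Sum>i\<in>I. norm (trig A1 a (\<theta> i)) ^ 2) \<le> 36864 * ?\<pi> ^ 2"
    proof -
      have "(\<Sum>n\<in>A1. norm (a n) ^ 2) \<le> (\<Sum>n\<in>A1. 1)"
        using sq by (intro sum_mono) (auto simp: A1_def)
      also have "\<dots> = real (card A1)" by simp
      also have "card A1 \<le> card {1..Q}"
        by (intro card_mono) (auto simp: A1_def primes_upto_def)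
      then have "real (card A1) \<le> real Q" by simp
      finally have aQ: "(\<Sum>n\<in>A1. norm (a n) ^ 2) \<le> real Q" .
      have "(\<Sum>i\<in>I. norm (trig A1 a (\<theta> i)) ^ 2) \<le> 36 * real N * (\<Sum>n\<in>A1. norm (a n) ^ 2)"
        using N by (intro large_sieve_separated A1 I sep) auto
      also have "\<dots> \<le> 36 * (real N * real Q)"
        using mult_left_mono[OF aQ, of "36 * real N"] by simp
      \<comment> \<open>From ln N \<le> 4 Q and Q^4 \<le> N follows N Q (ln N)^2 \<le> 16 N^2;
        Chebyshev's lower bound for \<pi>(N) then cancels the logarithms.\<close>
      also have "real N * real Q \<le> 1024 * ?\<pi> ^ 2"
      proof -
        have "ln (real N) \<le> 4 * real Q"
          using lnQ ln_add_one_self_le_self[of "real Q"] by simp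
        then have "ln (real N) ^ 2 \<le> (4 * real Q) ^ 2" using lnN by (intro power_mono) auto
        then have "real Q * ln (real N) ^ 2 \<le> real Q * (16 * real Q ^ 2)"
          by (intro mult_left_mono) (auto simp: power2_eq_square)
        also have "\<dots> = 16 * real Q ^ 3" by (simp add: power2_eq_square power3_eq_cube)
        also have "real Q ^ 3 \<le> real Q ^ 4" using Q1 by (intro power_increasing) auto
        also have "real Q ^ 4 \<le> real N" using Q(1) by (metis of_nat_le_iff of_nat_power)
        finally have "real N * (real Q * ln (real N) ^ 2) \<le> real N * (16 * real N)"
          by (intro mult_left_mono) auto
        also have "\<dots> = 16 * real N ^ 2" by (simp add: power2_eq_square)
        also have "real N ^ 2 \<le> (8 * ?\<pi> * ln (real N)) ^ 2" using cheb by (intro power_mono) auto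
        finally have "(real N * real Q) * ln (real N) ^ 2 \<le> (1024 * ?\<pi> ^ 2) * ln (real N) ^ 2"
          by (simp add: power_mult_distrib mult_ac)
        then show ?thesis using lnN by (simp add: mult_le_cancel_right)
      qed
      finally show ?thesis by simp
    qed
    have S2: "(\<Sum>i\<in>I. norm (trig A2 a (\<theta> i)) ^ 2) \<le> C1 * ?\<pi> ^ 2 * real (card I) powr \<epsilon>"
    proof -
      have cop: "coprime n q" if "n \<in> A2" "q \<in> {1..Q}" for n q
      proof -
        have "prime n" "\<not> n dvd q"
          using that by (auto simp: A2_def primes_upto_def dest: dvd_imp_le)
        then show ?thesis by (rule prime_imp_coprime)
      qed
      obtain B where B: "finite B" "\<forall>p\<in>B. prime p" "card B \<le> card I ^ 2"
        "ln (real (Suc Q)) * (\<Sum>i\<in>I. norm (trig A2 a (\<theta> i)) ^ 2) \<le>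
          72 * real N * (\<Prod>p\<in>B. euler_factor p) * (\<Sum>n\<in>A2. norm (a n) ^ 2)"
        using large_sieve_sifted[of N Q I \<theta> A2 a] N Q I sep A2 cop by auto
      let ?E = "\<Prod>p\<in>B. euler_factor p"
      have E0: "?E \<ge> 0"
        using B(2) euler_factor_ge_1 by (intro prod_nonneg) (auto intro: order_trans[OF zero_le_one])
      have "(\<Sum>n\<in>A2. norm (a n) ^ 2) \<le> (\<Sum>n\<in>A2. 1)"
        using sq by (intro sum_mono) (auto simp: A2_def)
      also have "\<dots> = real (card A2)" by simp
      also have "card A2 \<le> card ?P" by (intro card_mono) (auto simp: A2_def)
      then have "real (card A2) \<le> ?\<pi>" by simp
      finally have a2: "(\<Sum>n\<in>A2. norm (a n) ^ 2) \<le> ?\<pi>" .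
      have "?E \<le> C * real (Suc (card B)) powr (\<epsilon> / 2)" by (rule C(2)[OF B(1,2)])
      also have "\<dots> \<le> C * (2 * real (card I) ^ 2) powr (\<epsilon> / 2)"
      proof (intro mult_left_mono powr_mono2)
        have "real (card B) \<le> real (card I) ^ 2" using B(3) by (metis of_nat_le_iff of_nat_power)
        moreover have "1 \<le> real (card I) ^ 2" using J1 by (simp add: one_le_power)
        ultimately show "real (Suc (card B)) \<le> 2 * real (card I) ^ 2"
          unfolding of_nat_Suc by linarith
      qed (use C eps in auto)
      also have "(2 * real (card I) ^ 2) powr (\<epsilon> / 2) = 2 powr (\<epsilon> / 2) * real (card I) powr \<epsilon>"
        using powr_powr[of "real (card I)" 2 "\<epsilon> / 2"] J1 by (simp add: powr_mult)
      finally have E: "?E \<le> C * 2 powr (\<epsilon> / 2) * real (card I) powr \<epsilon>" by (simp add: mult_ac)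
      have "ln (real (Suc Q)) * (\<Sum>i\<in>I. norm (trig A2 a (\<theta> i)) ^ 2) \<le> 72 * real N * ?E * ?\<pi>"
        using B(4) a2 E0 by (meson mult_left_mono mult_nonneg_nonneg of_nat_0_le_iff order_trans zero_le_numeral)
      also have "\<dots> = 72 * ?E * ?\<pi> * real N" by simp
      also have "\<dots> \<le> 72 * ?E * ?\<pi> * (8 * ?\<pi> * (4 * ln (real (Suc Q))))"
      proof (rule mult_left_mono)
        have "8 * ?\<pi> * ln (real N) \<le> 8 * ?\<pi> * (4 * ln (real (Suc Q)))"
          using lnQ by (intro mult_left_mono) auto
        then show "real N \<le> 8 * ?\<pi> * (4 * ln (real (Suc Q)))" using cheb by linarith
      qed (use E0 in auto)
      also have "\<dots> = ln (real (Suc Q)) * (2304 * ?\<pi> ^ 2 * ?E)" by (simp add: power2_eq_square)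
      finally have "(\<Sum>i\<in>I. norm (trig A2 a (\<theta> i)) ^ 2) \<le> 2304 * ?\<pi> ^ 2 * ?E"
        using Q1 by (simp add: mult_le_cancel_left)
      also have "\<dots> \<le> 2304 * ?\<pi> ^ 2 * (C * 2 powr (\<epsilon> / 2) * real (card I) powr \<epsilon>)"
        using E by (intro mult_left_mono) auto
      finally show ?thesis by (simp add: C1_def mult_ac)
    qed
    have "(\<Sum>i\<in>I. norm (trig ?P a (\<theta> i)) ^ 2) \<le>
        (\<Sum>i\<in>I. 2 * norm (trig A1 a (\<theta> i)) ^ 2 + 2 * norm (trig A2 a (\<theta> i)) ^ 2)"
    proof (rule sum_mono)
      fix i
      let ?x = "norm (trig A1 a (\<theta> i))" and ?y = "norm (trig A2 a (\<theta> i))"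
      have "norm (trig ?P a (\<theta> i)) ^ 2 \<le> (?x + ?y) ^ 2"
        unfolding split by (intro power_mono norm_triangle_ineq) auto
      also have "\<dots> \<le> 2 * ?x ^ 2 + 2 * ?y ^ 2"
        using sum_squares_bound[of ?x ?y] by (simp add: power2_sum)
      finally show "norm (trig ?P a (\<theta> i)) ^ 2 \<le> 2 * ?x ^ 2 + 2 * ?y ^ 2" .
    qed
    also have "\<dots> = 2 * (\<Sum>i\<in>I. norm (trig A1 a (\<theta> i)) ^ 2) + 2 * (\<Sum>i\<in>I. norm (trig A2 a (\<theta> i)) ^ 2)"
      by (simp add: sum.distrib sum_distrib_left)
    also have "\<dots> \<le> 2 * (36864 * ?\<pi> ^ 2 * real (card I) powr \<epsilon>) + 2 * (C1 * ?\<pi> ^ 2 * real (card I) powr \<epsilon>)"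
    proof -
      have "36864 * ?\<pi> ^ 2 * 1 \<le> 36864 * ?\<pi> ^ 2 * real (card I) powr \<epsilon>"
        using Jeps by (intro mult_left_mono) auto
      then show ?thesis using S1 S2 by linarith
    qed
    finally show ?thesis by (simp add: algebra_simps)
  qed simp
  moreover have "2 * 36864 + 2 * C1 > 0" using C(1) by (simp add: C1_def add_pos_pos)
  ultimately show ?thesis by blast
qed

section \<open>From mean squares to higher powers\<close>

text \<open>The \<open>j\<close>-th largest of the numbers \<open>x i\<close> is at most \<open>D * j powr (\<epsilon> - 1)\<close>.\<close>

lemma sum_powr_le_of_subset_sums:
  fixes x :: "'i \<Rightarrow> real"
  assumes "finite I" "\<And>i. i \<in> I \<Longrightarrow> x i \<ge> 0" "D \<ge> 0" "s > 0"
    and "\<And>T. T \<subseteq> I \<Longrightarrow> (\<Sum>i\<in>T. x i) \<le> D * real (card T) powr \<epsilon>"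
  shows "(\<Sum>i\<in>I. x i powr s) \<le> D powr s * (\<Sum>j=1..card I. real j powr ((\<epsilon> - 1) * s))"
  using assms(1,2,5)
proof (induction "card I" arbitrary: I)
  case 0
  then show ?case by simp
next
  case (Suc n)
  have "I \<noteq> {}" using Suc.hyps(2) by auto
  then have "Min (x ` I) \<in> x ` I" using Suc.prems(1) by (intro Min_in) auto
  then obtain i where i: "i \<in> I" "x i = Min (x ` I)" by auto
  have le: "x i \<le> x j" if "j \<in> I" for j
    unfolding i(2) using that Suc.prems(1) by (intro Min_le) auto
  have cI: "card I = Suc n" using Suc.hyps(2) by simp
  \<comment> \<open>The smallest of the n + 1 values is at most their average; the induction
    hypothesis handles the rest.\<close>
  have "real (Suc n) * x i = (\<Sum>j\<in>I. x i)" by (simp add: cI)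
  also have "\<dots> \<le> (\<Sum>j\<in>I. x j)" using le by (intro sum_mono)
  also have "\<dots> \<le> D * real (Suc n) powr \<epsilon>" using Suc.prems(3)[of I] cI by simp
  finally have "x i \<le> D * real (Suc n) powr (\<epsilon> - 1)"
    by (simp add: powr_diff field_simps)
  then have "x i powr s \<le> (D * real (Suc n) powr (\<epsilon> - 1)) powr s"
    using i(1) Suc.prems(2) assms(4) by (intro powr_mono2) auto
  also have "\<dots> = D powr s * real (Suc n) powr ((\<epsilon> - 1) * s)"
    using assms(3) by (simp add: powr_mult powr_powr)
  finally have xi: "x i powr s \<le> D powr s * real (Suc n) powr ((\<epsilon> - 1) * s)" .
  have card: "card (I - {i}) = n" using i(1) Suc.prems(1) cI by simp
  have "(\<Sum>j\<in>I - {i}. x j powr s) \<le>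
      D powr s * (\<Sum>j=1..card (I - {i}). real j powr ((\<epsilon> - 1) * s))"
    using Suc.prems card by (intro Suc.hyps(1)) auto
  moreover have "(\<Sum>j\<in>I. x j powr s) = x i powr s + (\<Sum>j\<in>I - {i}. x j powr s)"
    using Suc.prems(1) i(1) by (rule sum.remove)
  ultimately show ?case using xi card unfolding cI by (simp add: distrib_left)
qed

text \<open>The bound for squares holds on every subset of \<open>I\<close>, so the squares in
  decreasing order decay like j^(\<epsilon> - 1), and their powers p/2 > 1 are summable for small
  \<epsilon>.\<close>

lemma trig_primes_sum_powr_le:
  fixes p :: real
  assumes p: "p > 2"
  shows "\<exists>C>0. \<forall>N\<ge>2. \<forall>a (I :: 'i set) \<theta>. (\<forall>n\<in>primes_upto N. norm (a n) \<le> 1) \<longrightarrow> finite I \<longrightarrow>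
    separated (1 / (2 * real N)) I \<theta> \<longrightarrow>
    (\<Sum>i\<in>I. norm (trig (primes_upto N) a (\<theta> i)) powr p) \<le> C * real (card (primes_upto N)) powr p"
proof -
  define s where "s = p / 2"
  \<comment> \<open>Chosen so that (\<epsilon> - 1) s = -(s + 1)/2 < -1, which makes the series
    \<open>K\<close> converge.\<close>
  define \<epsilon> where "\<epsilon> = (1 - 1 / s) / 2"
  have s: "s > 1" using p by (simp add: s_def)
  have eps: "\<epsilon> > 0" using s by (simp add: \<epsilon>_def)
  have "(\<epsilon> - 1) * s = - (s + 1) / 2" using s by (simp add: \<epsilon>_def field_simps)
  then have ex: "(\<epsilon> - 1) * s < -1" using s by simp
  obtain C where C: "C > 0" "\<And>N a (I :: 'i set) \<theta>. N \<ge> 2 \<Longrightarrow> \<forall>n\<in>primes_upto N. norm (a n) \<le> 1 \<Longrightarrow>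
    finite I \<Longrightarrow> separated (1 / (2 * real N)) I \<theta> \<Longrightarrow>
    (\<Sum>i\<in>I. norm (trig (primes_upto N) a (\<theta> i)) ^ 2) \<le>
      C * real (card (primes_upto N)) ^ 2 * real (card I) powr \<epsilon>"
    using trig_primes_sum_squares_le[OF eps, where 'i = 'i] by blast
  have summ: "summable (\<lambda>j. real j powr ((\<epsilon> - 1) * s))"
    using ex by (simp add: summable_real_powr_iff)
  define K where "K = (\<Sum>j. real j powr ((\<epsilon> - 1) * s))"
  have K: "(\<Sum>j=1..n. real j powr ((\<epsilon> - 1) * s)) \<le> K" for n
    unfolding K_def using summ by (intro sum_le_suminf) auto
  have K1: "K \<ge> 1" using K[of 1] by simp
  have "(\<Sum>i\<in>I. norm (trig (primes_upto N) a (\<theta> i)) powr p) \<le>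
      (C powr s * K) * real (card (primes_upto N)) powr p"
    if N: "N \<ge> 2" and a: "\<forall>n\<in>primes_upto N. norm (a n) \<le> 1" and I: "finite I"
      and sep: "separated (1 / (2 * real N)) I \<theta>" for N a and I :: "'i set" and \<theta>
  proof -
    let ?f = "\<lambda>i. norm (trig (primes_upto N) a (\<theta> i))"
    let ?\<pi> = "real (card (primes_upto N))"
    have sqp: "(y ^ 2) powr s = y powr p" if "y \<ge> 0" for y
      using powr_powr[of y 2 s] that by (simp add: s_def)
    have "(\<Sum>i\<in>I. ?f i powr p) = (\<Sum>i\<in>I. (?f i ^ 2) powr s)"
      by (simp add: sqp)
    also have "\<dots> \<le> (C * ?\<pi> ^ 2) powr s * (\<Sum>j=1..card I. real j powr ((\<epsilon> - 1) * s))"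
    proof (rule sum_powr_le_of_subset_sums[OF I])
      fix T assume "T \<subseteq> I"
      then show "(\<Sum>i\<in>T. ?f i ^ 2) \<le> C * ?\<pi> ^ 2 * real (card T) powr \<epsilon>"
        using finite_subset[OF _ I] separated_subset[OF sep] by (intro C(2) N a) auto
    qed (use C s in auto)
    also have "\<dots> \<le> (C * ?\<pi> ^ 2) powr s * K"
      by (intro mult_left_mono K) auto
    also have "(C * ?\<pi> ^ 2) powr s = C powr s * ?\<pi> powr p"
      using C(1) by (simp add: powr_mult sqp)
    finally show ?thesis by (simp add: mult_ac)
  qed
  moreover have "C powr s * K > 0" using C(1) K1 by simp
  ultimately show ?thesis by blast
qed

section \<open>$L^p$ norms\<close>

lemma integral_split_equal_parts:
  fixes g :: "real \<Rightarrow> real"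
  assumes "continuous_on UNIV g" "h \<ge> 0"
  shows "integral {0..real m * h} g = (\<Sum>j<m. integral {real j * h..real (Suc j) * h} g)"
proof (induction m)
  case (Suc m)
  have "integral {0..real m * h} g + integral {real m * h..real (Suc m) * h} g =
      integral {0..real (Suc m) * h} g"
    using assms by (intro Henstock_Kurzweil_Integration.integral_combine integrable_continuous_real)
      (auto intro: continuous_on_subset simp: distrib_right)
  then show ?case using Suc by simp
qed simp

text \<open>In units of the cell length 1/(2N), a difference of points deviates from the difference
  of the cell indices by at most 1. Distinct indices of equal parity differ by at least 2, even
  modulo the period, since it has the even number 2N of cells.\<close>

lemma separated_same_parity:
  assumes N: "N \<ge> 1" and J: "J \<subseteq> {..<2 * N}"
    and par: "\<And>i j. i \<in> J \<Longrightarrow> j \<in> J \<Longrightarrow> even (int i - int j)"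
    and \<theta>: "\<And>j. j \<in> J \<Longrightarrow> \<theta> j \<in> {real j * (1 / (2 * real N))..real (Suc j) * (1 / (2 * real N))}"
  shows "separated (1 / (2 * real N)) J \<theta>"
  unfolding separated_def
proof (intro ballI impI allI)
  fix i j and m :: int
  assume ij: "i \<in> J" "j \<in> J" "i \<noteq> j"
  define t where "t = 2 * real N * (\<theta> i - \<theta> j - of_int m)"
  define k where "k = int i - int j - 2 * int N * m"
  have bnd: "real j \<le> 2 * real N * \<theta> j" "2 * real N * \<theta> j \<le> real j + 1" if "j \<in> J" for j
    using \<theta>[OF that] N by (simp_all add: field_simps)
  have "\<bar>t - of_int k\<bar> \<le> 1"
    using bnd[OF ij(1)] bnd[OF ij(2)] by (simp add: t_def k_def algebra_simps abs_le_iff)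
  moreover have "\<bar>k\<bar> \<ge> 2"
  proof -
    have "even k" using par[OF ij(1,2)] by (simp add: k_def)
    moreover have "k \<noteq> 0"
    proof
      assume "k = 0"
      then have eq: "int i - int j = 2 * int N * m" by (simp add: k_def)
      moreover have "i < 2 * N" "j < 2 * N" using ij J by auto
      then have "\<bar>int i - int j\<bar> < 2 * int N" by linarith
      ultimately have "\<bar>2 * int N * m\<bar> < 2 * int N" by simp
      then have "m = 0" using N by (simp add: abs_mult mult_less_cancel_left1)
      then show False using eq ij(3) by simp
    qed
    ultimately show ?thesis by (auto elim!: evenE)
  qed
  ultimately have "\<bar>t\<bar> \<ge> 1" by linarith
  also have "\<bar>t\<bar> = 2 * real N * \<bar>\<theta> i - \<theta> j - of_int m\<bar>" by (simp add: t_def abs_mult)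
  finally show "1 / (2 * real N) \<le> \<bar>\<theta> i - \<theta> j - of_int m\<bar>"
    using N by (simp add: field_simps)
qed

lemma continuous_norm_trig_powr:
  "p > 0 \<Longrightarrow> continuous_on S (\<lambda>x. norm (trig A a x) powr p)"
  by (intro continuous_on_powr' continuous_intros) auto

text \<open>On each of 2N equal cells the integral is at most the length times the maximum. The
  maximizing points of the even cells are separated, and so are those of the odd cells, so the
  discrete bound is applied twice.\<close>

lemma integral_trig_primes_le:
  fixes p :: real
  assumes p: "p > 2"
  shows "\<exists>C>0. \<forall>N\<ge>2. \<forall>a. (\<forall>n\<in>primes_upto N. norm (a n) \<le> 1) \<longrightarrow>
    integral {0..1} (\<lambda>x. norm (trig (primes_upto N) a x) powr p) \<le>
      C * (real (card (primes_upto N)) powr p / real N)"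
proof -
  obtain C where C: "C > 0" "\<And>N a (I :: nat set) \<theta>. N \<ge> 2 \<Longrightarrow> \<forall>n\<in>primes_upto N. norm (a n) \<le> 1 \<Longrightarrow>
    finite I \<Longrightarrow> separated (1 / (2 * real N)) I \<theta> \<Longrightarrow>
    (\<Sum>i\<in>I. norm (trig (primes_upto N) a (\<theta> i)) powr p) \<le> C * real (card (primes_upto N)) powr p"
    using trig_primes_sum_powr_le[OF p, where 'i = nat] by blast
  have "integral {0..1} (\<lambda>x. norm (trig (primes_upto N) a x) powr p) \<le>
      C * (real (card (primes_upto N)) powr p / real N)"
    if N: "N \<ge> 2" and a: "\<forall>n\<in>primes_upto N. norm (a n) \<le> 1" for N a
  proof -
    define h where "h = 1 / (2 * real N)"
    have h0: "h > 0" using N by (simp add: h_def)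
    define g where "g = (\<lambda>x. norm (trig (primes_upto N) a x) powr p)"
    have cont: "continuous_on S g" for S
      unfolding g_def using p by (intro continuous_norm_trig_powr) auto
    have "\<exists>t\<in>{real j * h..real (Suc j) * h}. \<forall>x\<in>{real j * h..real (Suc j) * h}. g x \<le> g t" for j
      using h0 by (intro continuous_attains_sup cont) (auto simp: distrib_right)
    then obtain \<theta> where \<theta>: "\<And>j. \<theta> j \<in> {real j * h..real (Suc j) * h}"
      "\<And>j x. x \<in> {real j * h..real (Suc j) * h} \<Longrightarrow> g x \<le> g (\<theta> j)" by metis
    have parity: "(\<Sum>j\<in>{j. j < 2 * N \<and> even j = b}. g (\<theta> j)) \<le> C * real (card (primes_upto N)) powr p" for b
      unfolding g_def
    proof (rule C(2)[OF N a])
      show "separated (1 / (2 * real N)) {j. j < 2 * N \<and> even j = b} \<theta>"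
        using N \<theta>(1) unfolding h_def by (intro separated_same_parity) auto
    qed simp
    have "integral {0..1} g = integral {0..real (2 * N) * h} g" using N by (simp add: h_def)
    also have "\<dots> = (\<Sum>j<2 * N. integral {real j * h..real (Suc j) * h} g)"
      using h0 by (intro integral_split_equal_parts cont) auto
    also have "\<dots> \<le> (\<Sum>j<2 * N. h * g (\<theta> j))"
    proof (intro sum_mono)
      fix j
      have "integral {real j * h..real (Suc j) * h} g \<le> integral {real j * h..real (Suc j) * h} (\<lambda>x. g (\<theta> j))"
        using \<theta>(2) by (intro integral_le integrable_continuous_real cont) auto
      then show "integral {real j * h..real (Suc j) * h} g \<le> h * g (\<theta> j)"
        using h0 by (simp add: algebra_simps)
    qed
    also have "\<dots> = h * (\<Sum>j<2 * N. g (\<theta> j))" by (simp add: sum_distrib_left)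
    also have "(\<Sum>j<2 * N. g (\<theta> j)) =
        (\<Sum>j\<in>{j. j < 2 * N \<and> even j = True}. g (\<theta> j)) + (\<Sum>j\<in>{j. j < 2 * N \<and> even j = False}. g (\<theta> j))"
      by (subst sum.union_disjoint[symmetric]) (auto intro!: sum.cong)
    also have "h * \<dots> \<le> h * (C * real (card (primes_upto N)) powr p + C * real (card (primes_upto N)) powr p)"
      using h0 by (intro mult_left_mono add_mono parity) auto
    also have "\<dots> = C * (real (card (primes_upto N)) powr p / real N)"
      using N by (simp add: h_def field_simps)
    finally show ?thesis by (simp add: g_def)
  qed
  then show ?thesis using C(1) by blast
qed

text \<open>On [0, 1/(6N)] every term has real part at least 1/2, so nothing cancels.\<close>

lemma integral_trig_one_ge:
  fixes p :: real
  assumes p: "p > 0" and N: "N \<ge> 1" and A: "A \<subseteq> {1..N}"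
  shows "(real (card A) / 2) powr p / (6 * real N) \<le> integral {0..1} (\<lambda>x. norm (trig A (\<lambda>_. 1) x) powr p)"
proof -
  define h where "h = 1 / (6 * real N)"
  have h: "h > 0" "h \<le> 1" using N by (auto simp: h_def field_simps)
  have ge: "real (card A) / 2 \<le> norm (trig A (\<lambda>_. 1) x)" if x: "x \<in> {0..h}" for x
  proof -
    have "real (card A) / 2 = (\<Sum>n\<in>A. 1 / 2)" by simp
    also have "\<dots> \<le> (\<Sum>n\<in>A. Re (e (real n * x)))"
    proof (intro sum_mono Re_e_ge_half)
      fix n assume "n \<in> A"
      then have "real n * x \<le> real N * h" using A x by (intro mult_mono) auto
      then show "\<bar>real n * x\<bar> \<le> 1 / 6" using x N by (simp add: h_def)
    qed
    also have "\<dots> = Re (trig A (\<lambda>_. 1) x)" by (simp add: trig_def)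
    also have "\<dots> \<le> norm (trig A (\<lambda>_. 1) x)" by (rule complex_Re_le_cmod)
    finally show ?thesis .
  qed
  have "(real (card A) / 2) powr p / (6 * real N) = integral {0..h} (\<lambda>x. (real (card A) / 2) powr p)"
    using h by (simp add: h_def)
  also have "\<dots> \<le> integral {0..h} (\<lambda>x. norm (trig A (\<lambda>_. 1) x) powr p)"
    using ge p by (intro integral_le integrable_continuous_real continuous_norm_trig_powr powr_mono2) auto
  also have "\<dots> \<le> integral {0..1} (\<lambda>x. norm (trig A (\<lambda>_. 1) x) powr p)"
    using h p by (intro integral_subset_le integrable_continuous_real continuous_norm_trig_powr) auto
  finally show ?thesis .
qed

text \<open>Passes from the Bochner integral over [0,1) to the gauge integral over [0,1]:
  integrability excludes the junk value, and the endpoint is a null set.\<close>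

lemma Lp_norm_trig:
  assumes "p > 0"
  shows "Lp_norm p circle_measure (trig A a) = integral {0..1} (\<lambda>x. norm (trig A a x) powr p) powr (1 / p)"
proof -
  let ?g = "\<lambda>x. norm (trig A a x) powr p"
  have "set_integrable lborel {0..1} ?g"
    using assms by (intro borel_integrable_atLeastAtMost' continuous_norm_trig_powr)
  then have int: "set_integrable lborel {0..<1} ?g"
    by (rule set_integrable_subset) auto
  have "(LINT x|circle_measure. ?g x) = (LINT x:{0..<1}|lborel. ?g x)"
    unfolding circle_measure_def set_lebesgue_integral_def
    by (subst integral_restrict_space) auto
  also have "\<dots> = integral {0..<1} ?g"
    using int by (rule set_borel_integral_eq_integral(2))
  also have "\<dots> = integral {0..1} ?g"
    by (rule integral_spike_set) (auto intro: negligible_subset[of "{1}"])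
  finally show ?thesis by (simp add: Lp_norm_def)
qed

theorem theorem1p5:
  fixes p :: real
  assumes "p \<ge> 2"
  shows "\<exists>C::real. \<forall>N::nat. N \<ge> 1 \<longrightarrow>
    (\<forall>a :: nat \<Rightarrow> complex. (\<forall>n \<in> primes_upto N. norm (a n) \<le> 1) \<longrightarrow>
      Lp_norm p circle_measure (\<lambda>\<theta>. \<Sum>n\<in>primes_upto N. a n * e (real n * \<theta>))
        \<le> C * Lp_norm p circle_measure (\<lambda>\<theta>. \<Sum>n\<in>primes_upto N. e (real n * \<theta>)))"
proof -
  let ?I = "\<lambda>N a. integral {0..1} (\<lambda>x. norm (trig (primes_upto N) a x) powr p)"
  have p0: "p > 0" using assms by simp
  have I0: "?I N a \<ge> 0" for N a by (intro integral_nonneg integrable_continuous_real continuous_norm_trig_powr p0) auto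
  have "\<exists>C\<ge>0. \<forall>N\<ge>1. \<forall>a. (\<forall>n\<in>primes_upto N. norm (a n) \<le> 1) \<longrightarrow> ?I N a \<le> C * ?I N (\<lambda>_. 1)"
  proof (cases "p = 2")
    case True
    have I2: "?I N a = (\<Sum>n\<in>primes_upto N. norm (a n) ^ 2)" for N a
      using integral_unique[OF parseval_trig[of "primes_upto N" 0 1 a]] True by simp
    have "?I N a \<le> 1 * ?I N (\<lambda>_. 1)" if "\<forall>n\<in>primes_upto N. norm (a n) \<le> 1" for N a
      unfolding I2 mult_1 using that by (intro sum_mono power_mono) auto
    then show ?thesis by (intro exI[of _ 1]) auto
  next
    case False
    then have "p > 2" using assms by simp
    then obtain C where C: "C > 0" "\<And>N a. N \<ge> 2 \<Longrightarrow> \<forall>n\<in>primes_upto N. norm (a n) \<le> 1 \<Longrightarrow>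
        ?I N a \<le> C * (real (card (primes_upto N)) powr p / real N)"
      using integral_trig_primes_le by blast
    have "?I N a \<le> (6 * 2 powr p * C) * ?I N (\<lambda>_. 1)"
      if N: "N \<ge> 1" and a: "\<forall>n\<in>primes_upto N. norm (a n) \<le> 1" for N a
    proof (cases "N \<ge> 2")
      case True
      have "?I N a \<le> C * (real (card (primes_upto N)) powr p / real N)" by (rule C(2)[OF True a])
      \<comment> \<open>The factor 6 * 2^p undoes the losses in the lower bound for the
        majorant.\<close>
      also have "\<dots> = (6 * 2 powr p * C) * ((real (card (primes_upto N)) / 2) powr p / (6 * real N))"
        using N by (simp add: powr_divide)
      also have "\<dots> \<le> (6 * 2 powr p * C) * ?I N (\<lambda>_. 1)"
        using C(1) by (intro mult_left_mono integral_trig_one_ge p0 N primes_upto_subset) auto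
      finally show ?thesis .
    next
      case False
      \<comment> \<open>There are no primes up to 1, so both integrals vanish.\<close>
      then have "N = 1" using N by simp
      have "primes_upto N = {}" unfolding \<open>N = 1\<close> by (auto simp: primes_upto_def)
      then show ?thesis using p0 by (simp add: trig_def)
    qed
    then show ?thesis using C(1) by (intro exI[of _ "6 * 2 powr p * C"]) auto
  qed
  then obtain C where C: "C \<ge> 0" "\<And>N a. N \<ge> 1 \<Longrightarrow> \<forall>n\<in>primes_upto N. norm (a n) \<le> 1 \<Longrightarrow>
      ?I N a \<le> C * ?I N (\<lambda>_. 1)" by blast
  have "Lp_norm p circle_measure (trig (primes_upto N) a) \<le>
      C powr (1 / p) * Lp_norm p circle_measure (trig (primes_upto N) (\<lambda>_. 1))"
    if N: "N \<ge> 1" and a: "\<forall>n\<in>primes_upto N. norm (a n) \<le> 1" for N a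
  proof -
    have "?I N a powr (1 / p) \<le> (C * ?I N (\<lambda>_. 1)) powr (1 / p)"
      using C(2)[OF N a] I0 p0 by (intro powr_mono2) auto
    then show ?thesis using C(1) I0 by (simp add: Lp_norm_trig[OF p0] powr_mult)
  qed
  then show ?thesis
    unfolding trig_def by (intro exI[of _ "C powr (1 / p)"]) auto
qed

end
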